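(* Let $(A_n)_{n\ge0}\in\mathcal{S}_\eta(\mathcal{O}_N)$. If the sequence $(A_n)$ is stable, then the sequence $(s_1(A_n))$ is bounded below from zero by a positive constant. If the sequence $(A_n)$ fails to be stable, then $$\lim_{n\to\infty}s_k(A_n)=0\quad\text{for each } k\ge1.$$
   Context: Let $N\ge 2$ be an integer and $\mathbb{Z}^+=\{0,1,2,\dots\}$. For $n\ge 1$, $P_n$ is the orthogonal projection of $l^2(\mathbb{Z}^+)$ onto the span of the first $n$ standard basis vectors. For $i\in\{0,\dots,N-1\}$, $S_i\in L(l^2(\mathbb{Z}^+))$ is the isometry $(S_i x)_{rN+i}=x_r$ for $r\ge 0$, with all other components of $S_ix$ equal to $0$. The concrete Cuntz algebra $\mathcal{O}_N$ is the smallest $C^*$-subalgebra of $L(l^2(\mathbb{Z}^+))$ containing $S_0,\dots,S_{N-1}$. Let $\mathcal{F}_\eta$ (with $\eta(n)=N^n$) be the $C^*$-algebra of all bounded sequences $(A_n)_{n\ge 0}$ with $A_n\in\mathbb{C}^{N^n\times N^n}$ (identified with operators on $\mathrm{im}\,P_{N^n}$), with entrywise operations and supremum norm. $\mathcal{S}_\eta(\mathcal{O}_N)$ is the smallest $C^*$-subalgebra of $\mathcal{F}_\eta$ containing all sequences $(P_{N^n}AP_{N^n})_{n\ge0}$ with $A\in\mathcal{O}_N$. A sequence $(A_n)\in\mathcal{F}_\eta$ is stable if there is an $n_0$ such that $A_n$ is invertible for all $n\ge n_0$ and $\sup_{n\ge n_0}\|A_n^{-1}\|<\infty$. For $A_n\in\mathbb{C}^{N^n\times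 N^n}$, $0\le s_1(A_n)\le s_2(A_n)\le\dots\le s_{N^n}(A_n)=\|A_n\|$ denote the singular values of $A_n$ in increasing order, counted with multiplicity ($s_k(A_n)$ is considered only for $n$ with $N^n\ge k$).
   Formalization: For stable sequences, s_1(A_n) is bounded below by a positive constant for all sufficiently large n, not for every n≥0; the latter fails, e.g. for sections of the unitary S_0S_1*+S_1S_0*+Σ_{i≥2}S_iS_i*, where A_0=0. *)

theory Defs
  imports
    "HOL-Analysis.Bounded_Linear_Function"
    "HOL-Computational_Algebra.Fundamental_Theorem_Algebra"
    "Jordan_Normal_Form.Schur_Decomposition"
begin

section \<open>The Hilbert space of square-summable complex sequences\<close>

lemma summable_l2_mult:
  fixes f g :: "nat \<Rightarrow> real"
  assumes "summable (\<lambda>n. (f n)\<^sup>2)" "summable (\<lambda>n. (g n)\<^sup>2)"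
  shows "summable (\<lambda>n. f n * g n)"
proof (rule summable_comparison_test')
  show "summable (\<lambda>n. (f n)\<^sup>2 + (g n)\<^sup>2)"
    using assms by (rule summable_add)
  fix n :: nat
  have "0 \<le> (\<bar>f n\<bar> - \<bar>g n\<bar>)\<^sup>2" by simp
  then have "2 * (\<bar>f n\<bar> * \<bar>g n\<bar>) \<le> (f n)\<^sup>2 + (g n)\<^sup>2"
    by (simp add: power2_diff)
  moreover have "0 \<le> \<bar>f n\<bar> * \<bar>g n\<bar>" by simp
  ultimately show "norm (f n * g n) \<le> (f n)\<^sup>2 + (g n)\<^sup>2"
    unfolding real_norm_def abs_mult by linarith
qed

lemma summable_l2_add:
  fixes x y :: "nat \<Rightarrow> complex"
  assumes x: "summable (\<lambda>n. (cmod (x n))\<^sup>2)" and y: "summable (\<lambda>n. (cmod (y n))\<^sup>2)"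
  shows "summable (\<lambda>n. (cmod (x n + y n))\<^sup>2)"
proof (rule summable_comparison_test')
  show "summable (\<lambda>n. (cmod (x n))\<^sup>2 + (cmod (y n))\<^sup>2 + 2 * (cmod (x n) * cmod (y n)))"
    by (intro summable_add summable_mult summable_l2_mult x y)
  fix n :: nat
  have "(cmod (x n + y n))\<^sup>2 \<le> (cmod (x n) + cmod (y n))\<^sup>2"
    by (rule power_mono) (auto intro: norm_triangle_ineq)
  then show "norm ((cmod (x n + y n))\<^sup>2) \<le> (cmod (x n))\<^sup>2 + (cmod (y n))\<^sup>2 + 2 * (cmod (x n) * cmod (y n))"
    by (simp add: power2_sum)
qed

lemma summable_l2_mult_const:
  fixes x :: "nat \<Rightarrow> complex"
  assumes "summable (\<lambda>n. (cmod (x n))\<^sup>2)"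
  shows "summable (\<lambda>n. (cmod (c * x n))\<^sup>2)"
  using assms by (simp add: norm_mult power_mult_distrib summable_mult)

typedef ell2 = "{x :: nat \<Rightarrow> complex. summable (\<lambda>n. (cmod (x n))\<^sup>2)}"
  morphisms coord Abs_ell2
  by (rule exI[of _ "\<lambda>_. 0"]) simp

setup_lifting type_definition_ell2

lemma summable_coord: "summable (\<lambda>n. (cmod (coord x n))\<^sup>2)"
  using coord[of x] by simp

lemma summable_cinner: "summable (\<lambda>n. coord x n * cnj (coord y n))"
  by (rule summable_norm_cancel)
    (simp add: norm_mult summable_l2_mult summable_coord)

definition cinner :: "ell2 \<Rightarrow> ell2 \<Rightarrow> complex" where
  "cinner x y = (\<Sum>n. coord x n * cnj (coord y n))"

instantiation ell2 :: real_inner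
begin

lift_definition zero_ell2 :: ell2 is "\<lambda>_. 0" by simp
lift_definition plus_ell2 :: "ell2 \<Rightarrow> ell2 \<Rightarrow> ell2" is "\<lambda>x y n. x n + y n"
  by (rule summable_l2_add)
lift_definition uminus_ell2 :: "ell2 \<Rightarrow> ell2" is "\<lambda>x n. - x n" by simp
lift_definition minus_ell2 :: "ell2 \<Rightarrow> ell2 \<Rightarrow> ell2" is "\<lambda>x y n. x n - y n"
  using summable_l2_add[of _ "\<lambda>n. - _ n"] by simp
lift_definition scaleR_ell2 :: "real \<Rightarrow> ell2 \<Rightarrow> ell2" is "\<lambda>r x n. complex_of_real r * x n"
  by (rule summable_l2_mult_const)

definition inner_ell2 :: "ell2 \<Rightarrow> ell2 \<Rightarrow> real" where
  "inner_ell2 x y = Re (cinner x y)"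
definition norm_ell2 :: "ell2 \<Rightarrow> real" where
  "norm_ell2 x = sqrt (inner x x)"
definition sgn_ell2 :: "ell2 \<Rightarrow> ell2" where
  "sgn_ell2 x = scaleR (inverse (norm x)) x"
definition dist_ell2 :: "ell2 \<Rightarrow> ell2 \<Rightarrow> real" where
  "dist_ell2 x y = norm (x - y)"
definition uniformity_ell2 :: "(ell2 \<times> ell2) filter" where
  "uniformity_ell2 = (INF e\<in>{0<..}. principal {(x, y). dist x y < e})"
definition open_ell2 :: "ell2 set \<Rightarrow> bool" where
  "open_ell2 U \<longleftrightarrow> (\<forall>x\<in>U. eventually (\<lambda>(x', y). x' = x \<longrightarrow> y \<in> U) uniformity)"

lemma inner_ell2_sum: "inner x y = (\<Sum>n. Re (coord x n * cnj (coord y n)))" for x y :: ell2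
  unfolding inner_ell2_def cinner_def
  by (rule bounded_linear.suminf[OF bounded_linear_Re summable_cinner])

lemma summable_inner_ell2: "summable (\<lambda>n. Re (coord x n * cnj (coord y n)))"
  by (rule bounded_linear.summable[OF bounded_linear_Re summable_cinner])

lemma inner_ell2_self: "inner x x = (\<Sum>n. (cmod (coord x n))\<^sup>2)" for x :: ell2
  unfolding inner_ell2_sum
  by (simp only: complex_norm_square[symmetric] Re_complex_of_real)

instance
proof
  fix x y z :: ell2 and r s :: real
  show "x + y + z = x + (y + z)" by transfer (simp add: algebra_simps)
  show "x + y = y + x" by transfer (simp add: algebra_simps)
  show "0 + x = x" by transfer simp
  show "- x + x = 0" by transfer simp
  show "x - y = x + - y" by transfer simp
  show "r *\<^sub>R (x + y) = r *\<^sub>R x + r *\<^sub>R y" by transfer (simp add: algebra_simps)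
  show "(r + s) *\<^sub>R x = r *\<^sub>R x + s *\<^sub>R x" by transfer (simp add: algebra_simps)
  show "r *\<^sub>R s *\<^sub>R x = (r * s) *\<^sub>R x" by transfer (simp add: algebra_simps)
  show "1 *\<^sub>R x = x" by transfer simp
  show "sgn x = scaleR (inverse (norm x)) x" by (rule sgn_ell2_def)
  show "dist x y = norm (x - y)" by (rule dist_ell2_def)
  show "uniformity = (INF e\<in>{0<..}. principal {(x, y :: ell2). dist x y < e})"
    by (rule uniformity_ell2_def)
  show "open U \<longleftrightarrow> (\<forall>x\<in>U. eventually (\<lambda>(x', y). x' = x \<longrightarrow> y \<in> U) uniformity)"
    for U :: "ell2 set" by (rule open_ell2_def)
  show "inner x y = inner y x"
    unfolding inner_ell2_sum by (simp add: mult.commute)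
  show "inner (x + y) z = inner x z + inner y z"
    unfolding inner_ell2_sum suminf_add[OF summable_inner_ell2 summable_inner_ell2]
    by (simp add: plus_ell2.rep_eq algebra_simps)
  show "inner (r *\<^sub>R x) y = r * inner x y"
    unfolding inner_ell2_sum suminf_mult[OF summable_inner_ell2, symmetric]
    by (simp add: scaleR_ell2.rep_eq algebra_simps)
  show "0 \<le> inner x x"
    unfolding inner_ell2_self by (rule suminf_nonneg[OF summable_coord]) simp
  show "inner x x = 0 \<longleftrightarrow> x = 0"
    unfolding inner_ell2_self
    by (subst suminf_eq_zero_iff[OF summable_coord])
      (auto simp: coord_inject[symmetric] zero_ell2.rep_eq fun_eq_iff)
  show "norm x = sqrt (inner x x)" by (rule norm_ell2_def)
qed

end

lemma norm_ell2_eq: "norm x = sqrt (\<Sum>n. (cmod (coord x n))\<^sup>2)" for x :: ell2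
  unfolding norm_ell2_def inner_ell2_self ..

lift_definition unit_ell2 :: "nat \<Rightarrow> ell2" is "\<lambda>j n. if n = j then 1 else 0"
proof -
  fix j :: nat
  have "summable (\<lambda>n. if n = j then 1 else 0 :: real)"
    using sums_If_finite_set[of "{j}" "\<lambda>_. 1 :: real"] by (auto simp: sums_iff)
  then show "summable (\<lambda>n. (cmod (if n = j then 1 else 0))\<^sup>2)"
    by (rule back_subst[of summable]) auto
qed

section \<open>Bounded operators on the Hilbert space\<close>

text \<open>\<^typ>\<open>ell2 \<Rightarrow>\<^sub>L ell2\<close> consists of the bounded \<^emph>\<open>real\<close>-linear maps; its norm is the
  operator norm.  Complex linearity is imposed by the carrier \<open>bounded_ops\<close> below.\<close>

lift_definition scaleC_ell2 :: "complex \<Rightarrow> ell2 \<Rightarrow> ell2" is "\<lambda>c x n. c * x n"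
  by (rule summable_l2_mult_const)

lemma norm_scaleC_ell2: "norm (scaleC_ell2 c x) = cmod c * norm x"
  by (simp add: norm_ell2_eq scaleC_ell2.rep_eq norm_mult power_mult_distrib
      suminf_mult summable_coord real_sqrt_mult)

lift_definition scalar_op :: "complex \<Rightarrow> ell2 \<Rightarrow>\<^sub>L ell2" is scaleC_ell2
proof (rule bounded_linear_intro)
  fix c :: complex and x y :: ell2 and r :: real
  show "scaleC_ell2 c (x + y) = scaleC_ell2 c x + scaleC_ell2 c y"
    by transfer (simp add: algebra_simps)
  show "scaleC_ell2 c (r *\<^sub>R x) = r *\<^sub>R scaleC_ell2 c x"
    by transfer (simp add: algebra_simps)
  show "norm (scaleC_ell2 c x) \<le> norm x * cmod c"
    by (simp add: norm_scaleC_ell2 mult.commute)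
qed

definition bounded_ops :: "(ell2 \<Rightarrow>\<^sub>L ell2) set" where
  "bounded_ops = {A. \<forall>c x. blinfun_apply A (scaleC_ell2 c x) = scaleC_ell2 c (blinfun_apply A x)}"

definition is_adjoint :: "(ell2 \<Rightarrow>\<^sub>L ell2) \<Rightarrow> (ell2 \<Rightarrow>\<^sub>L ell2) \<Rightarrow> bool" where
  "is_adjoint A B \<longleftrightarrow> (\<forall>x y. cinner (blinfun_apply A x) y = cinner x (blinfun_apply B y))"

definition cstar_subalgebra_ops :: "(ell2 \<Rightarrow>\<^sub>L ell2) set \<Rightarrow> bool" where
  "cstar_subalgebra_ops B \<longleftrightarrow>
     B \<subseteq> bounded_ops \<and> 0 \<in> B \<and> closed B \<and>
     (\<forall>S\<in>B. \<forall>T\<in>B. S + T \<in> B \<and> S o\<^sub>L T \<in> B) \<and>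
     (\<forall>S\<in>B. \<forall>c. scalar_op c o\<^sub>L S \<in> B) \<and>
     (\<forall>S\<in>B. \<forall>T. is_adjoint S T \<longrightarrow> T \<in> B)"

lift_definition proj_fun :: "nat \<Rightarrow> ell2 \<Rightarrow> ell2" is "\<lambda>d x n. if n < d then x n else 0"
proof -
  fix d :: nat and x :: "nat \<Rightarrow> complex"
  assume x: "summable (\<lambda>n. (cmod (x n))\<^sup>2)"
  show "summable (\<lambda>n. (cmod (if n < d then x n else 0))\<^sup>2)"
    by (rule summable_comparison_test'[OF x]) auto
qed

lift_definition proj :: "nat \<Rightarrow> ell2 \<Rightarrow>\<^sub>L ell2" is proj_fun
proof (rule bounded_linear_intro[where K = 1])
  fix d :: nat and x y :: ell2 and r :: real
  show "proj_fun d (x + y) = proj_fun d x + proj_fun d y" by transfer auto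
  show "proj_fun d (r *\<^sub>R x) = r *\<^sub>R proj_fun d x" by transfer auto
  show "norm (proj_fun d x) \<le> norm x * 1"
    unfolding norm_ell2_eq mult_1_right
    by (intro real_sqrt_le_mono suminf_le summable_coord) (simp add: proj_fun.rep_eq)
qed

section \<open>The concrete Cuntz algebra\<close>

lemma cuntz_partial_sum_le:
  fixes x :: "nat \<Rightarrow> complex"
  assumes "summable (\<lambda>n. (cmod (x n))\<^sup>2)"
  shows "(\<Sum>m<M. (cmod (if m mod N = i then x (m div N) else 0))\<^sup>2) \<le> (\<Sum>n. (cmod (x n))\<^sup>2)"
proof -
  let ?I = "{m\<in>{..<M}. m mod N = i}"
  have inj: "inj_on (\<lambda>m. m div N) ?I"
    by (rule inj_onI) (metis (mono_tags, lifting) div_mod_decomp mem_Collect_eq)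
  have "(\<Sum>m<M. (cmod (if m mod N = i then x (m div N) else 0))\<^sup>2)
      = (\<Sum>m\<in>?I. (cmod (x (m div N)))\<^sup>2)"
    by (subst sum.inter_filter) (auto intro: sum.cong)
  also have "\<dots> = (\<Sum>n\<in>(\<lambda>m. m div N) ` ?I. (cmod (x n))\<^sup>2)"
    by (subst sum.reindex[OF inj]) simp
  also have "\<dots> \<le> (\<Sum>n. (cmod (x n))\<^sup>2)"
    by (rule sum_le_suminf[OF assms]) auto
  finally show ?thesis .
qed

lemma summable_cuntz:
  fixes x :: "nat \<Rightarrow> complex"
  assumes "summable (\<lambda>n. (cmod (x n))\<^sup>2)"
  shows "summable (\<lambda>m. (cmod (if m mod N = i then x (m div N) else 0))\<^sup>2)"
  by (rule summableI_nonneg_bounded[OF _ cuntz_partial_sum_le[OF assms]]) simp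

text \<open>For \<open>i < N\<close>, the indices \<open>m\<close> with \<open>m mod N = i\<close> are exactly the \<open>m = r * N + i\<close>,
  and then \<open>r = m div N\<close>.\<close>

lift_definition cuntz_fun :: "nat \<Rightarrow> nat \<Rightarrow> ell2 \<Rightarrow> ell2" is
  "\<lambda>N i x m. if m mod N = i then x (m div N) else 0"
  by (rule summable_cuntz)

lift_definition cuntz_isometry :: "nat \<Rightarrow> nat \<Rightarrow> ell2 \<Rightarrow>\<^sub>L ell2" is cuntz_fun
proof (rule bounded_linear_intro[where K = 1])
  fix N i :: nat and x y :: ell2 and r :: real
  show "cuntz_fun N i (x + y) = cuntz_fun N i x + cuntz_fun N i y" by transfer auto
  show "cuntz_fun N i (r *\<^sub>R x) = r *\<^sub>R cuntz_fun N i x" by transfer auto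
  have "(\<Sum>m. (cmod (coord (cuntz_fun N i x) m))\<^sup>2) \<le> (\<Sum>n. (cmod (coord x n))\<^sup>2)"
    unfolding cuntz_fun.rep_eq
    by (intro suminf_le_const summable_cuntz cuntz_partial_sum_le summable_coord)
  then show "norm (cuntz_fun N i x) \<le> norm x * 1"
    unfolding norm_ell2_eq by simp
qed

definition cuntz_algebra :: "nat \<Rightarrow> (ell2 \<Rightarrow>\<^sub>L ell2) set" where
  "cuntz_algebra N =
     \<Inter>{B. cstar_subalgebra_ops B \<and> (\<forall>i<N. cuntz_isometry N i \<in> B)}"

section \<open>Matrices\<close>

definition vec2norm :: "complex vec \<Rightarrow> real" where
  "vec2norm v = sqrt (\<Sum>i<dim_vec v. (cmod (vec_index v i))\<^sup>2)"

definition mat_opnorm :: "complex mat \<Rightarrow> real" where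
  "mat_opnorm A = Sup {vec2norm (A *\<^sub>v v) |v. v \<in> carrier_vec (dim_col A) \<and> vec2norm v \<le> 1}"

text \<open>The singular values are the square roots of the (real, nonnegative) eigenvalues of
  \<open>A\<^sup>* A\<close>, listed in increasing order with multiplicity; \<open>sing_val k A\<close> is the \<open>k\<close>-th one,
  counting from 1, and is meaningful only for \<open>1 \<le> k \<le> dim_col A\<close>.\<close>

definition sing_val :: "nat \<Rightarrow> complex mat \<Rightarrow> real" where
  "sing_val k A =
     sorted_list_of_multiset
       (image_mset (\<lambda>z. sqrt (Re z)) (proots (char_poly (mat_adjoint A * A)))) ! (k - 1)"

text \<open>The matrix, in the standard basis of \<open>im P\<^sub>d\<close>, of the operator \<open>P\<^sub>d A P\<^sub>d\<close>.\<close>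

definition section_mat :: "nat \<Rightarrow> (ell2 \<Rightarrow>\<^sub>L ell2) \<Rightarrow> complex mat" where
  "section_mat d A =
     mat d d (\<lambda>(i, j). coord (blinfun_apply (proj d o\<^sub>L A o\<^sub>L proj d) (unit_ell2 j)) i)"

section \<open>Algebras of matrix sequences\<close>

definition seq_norm :: "(nat \<Rightarrow> complex mat) \<Rightarrow> real" where
  "seq_norm A = (SUP n. mat_opnorm (A n))"

definition F_eta :: "nat \<Rightarrow> (nat \<Rightarrow> complex mat) set" where
  "F_eta N = {A. (\<forall>n. A n \<in> carrier_mat (N ^ n) (N ^ n)) \<and>
                 bdd_above (range (\<lambda>n. mat_opnorm (A n)))}"

definition cstar_subalgebra_seq :: "nat \<Rightarrow> (nat \<Rightarrow> complex mat) set \<Rightarrow> bool" where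
  "cstar_subalgebra_seq N B \<longleftrightarrow>
     B \<subseteq> F_eta N \<and> (\<lambda>n. 0\<^sub>m (N ^ n) (N ^ n)) \<in> B \<and>
     (\<forall>S\<in>B. \<forall>T\<in>B. (\<lambda>n. S n + T n) \<in> B \<and> (\<lambda>n. S n * T n) \<in> B) \<and>
     (\<forall>S\<in>B. \<forall>c. (\<lambda>n. c \<cdot>\<^sub>m S n) \<in> B) \<and>
     (\<forall>S\<in>B. (\<lambda>n. mat_adjoint (S n)) \<in> B) \<and>
     (\<forall>S\<in>F_eta N. (\<forall>\<epsilon>>0. \<exists>T\<in>B. seq_norm (\<lambda>n. S n - T n) < \<epsilon>) \<longrightarrow> S \<in> B)"

definition S_eta :: "nat \<Rightarrow> (nat \<Rightarrow> complex mat) set" where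
  "S_eta N =
     \<Inter>{B. cstar_subalgebra_seq N B \<and>
          (\<forall>A\<in>cuntz_algebra N. (\<lambda>n. section_mat (N ^ n) A) \<in> B)}"

definition stable_seq :: "(nat \<Rightarrow> complex mat) \<Rightarrow> bool" where
  "stable_seq A \<longleftrightarrow>
     (\<exists>n\<^sub>0 M. \<forall>n\<ge>n\<^sub>0. invertible_mat (A n) \<and>
        (\<forall>B. inverts_mat (A n) B \<and> inverts_mat B (A n) \<longrightarrow> mat_opnorm B \<le> M))"

end

theory Submission
  imports Defs
begin

text \<open>
  The \<open>k\<close>-th singular values are forced to \<open>0\<close> by transporting one almost-null vector of some
  \<open>A\<^sub>m\<close> to many orthonormal almost-null vectors of every \<open>A\<^sub>n\<close> with \<open>n\<close> much larger than \<open>m\<close>.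

  Read the index of a basis vector as a word of base-\<open>N\<close> digits, lowest digit first.  Inserting a
  fixed block of \<open>n - m\<close> digits after the first \<open>p\<close> digits is an isometry \<open>J\<^sub>p\<close> with
  \<open>S\<^sub>i J\<^sub>p = J\<^sub>p\<^sub>+\<^sub>1 S\<^sub>i\<close>, and it intertwines \<open>P\<close> of size \<open>N\<^sup>m\<close> with \<open>P\<close> of size \<open>N\<^sup>n\<close>.  If the block is
  \<open>1 0\<^sup>m y\<close>, the ranges of the \<open>J\<^sub>p\<close> with \<open>p < m\<close> are mutually orthogonal, also for different \<open>y\<close>,
  so \<open>\<Phi> = m\<^sup>-\<^sup>1\<^sup>/\<^sup>2 (J\<^sub>0 + \<dots> + J\<^sub>m\<^sub>-\<^sub>1)\<close> is an isometry.  Its commutator with \<open>S\<^sub>i\<close> telescopes and has norm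
  at most \<open>2 / sqrt m\<close>.  Asymptotic commutation with \<open>\<Phi>\<close> and \<open>\<Phi>\<^sup>*\<close> survives sums, products,
  adjoints and norm limits, hence holds for all of \<open>S_eta N\<close>.  If \<open>(A\<^sub>n)\<close> is not stable, some \<open>A\<^sub>m\<close>
  with large \<open>m\<close> almost annihilates a unit vector \<open>x\<close>; then \<open>A\<^sub>n \<Phi> x \<approx> \<Phi> A\<^sub>m x \<approx> 0\<close>, and different
  choices of \<open>y\<close> give as many orthonormal vectors \<open>\<Phi> x\<close> as desired.
\<close>

subsection \<open>Singular values\<close>

lemma mat_adjoint_carrier [simp]: "A \<in> carrier_mat m n \<Longrightarrow> mat_adjoint A \<in> carrier_mat n m"
  by (auto simp: mat_adjoint_def mat_of_rows_def)

lemma dim_mat_adjoint [simp]: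
  "dim_row (mat_adjoint A) = dim_col A" "dim_col (mat_adjoint A) = dim_row A"
  by (auto simp: mat_adjoint_def mat_of_rows_def)

lemma index_mat_adjoint [simp]:
  "i < dim_col A \<Longrightarrow> j < dim_row A \<Longrightarrow> mat_adjoint A $$ (i, j) = conjugate (A $$ (j, i))"
  by (simp add: mat_adjoint_def mat_of_rows_index)

lemma mat_adjoint_adjoint [simp]: "mat_adjoint (mat_adjoint A) = A"
  by (rule eq_matI) auto

lemma index_mat_mult_sum:
  "i < dim_row A \<Longrightarrow> j < dim_col B \<Longrightarrow> dim_col A = dim_row B \<Longrightarrow>
    (A * B) $$ (i, j) = (\<Sum>k<dim_row B. A $$ (i, k) * B $$ (k, j))"
  by (simp add: times_mat_def scalar_prod_def atLeast0LessThan)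

lemma index_mult_vec_sum:
  "i < dim_row A \<Longrightarrow> dim_col A = dim_vec v \<Longrightarrow>
    (A *\<^sub>v v) $ i = (\<Sum>k<dim_vec v. A $$ (i, k) * v $ k)"
  by (simp add: mult_mat_vec_def scalar_prod_def atLeast0LessThan)

lemma mat_adjoint_mult:
  fixes A B :: "complex mat"
  assumes "A \<in> carrier_mat m n" "B \<in> carrier_mat n k"
  shows "mat_adjoint (A * B) = mat_adjoint B * mat_adjoint A"
proof (rule eq_matI)
  fix i j assume "i < dim_row (mat_adjoint B * mat_adjoint A)"
    "j < dim_col (mat_adjoint B * mat_adjoint A)"
  with assms show "mat_adjoint (A * B) $$ (i, j) = (mat_adjoint B * mat_adjoint A) $$ (i, j)"
    by (simp add: index_mat_mult_sum mult.commute del: index_mult_mat(1))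
qed (use assms in auto)

lemma vec2norm_square: "complex_of_real ((vec2norm v)\<^sup>2) = v \<bullet>c v"
  by (simp add: vec2norm_def sum_nonneg scalar_prod_def atLeast0LessThan
      complex_norm_square[unfolded of_real_power])

lemma vec2norm_nonneg [simp]: "0 \<le> vec2norm v"
  by (simp add: vec2norm_def sum_nonneg)

lemma vec2norm_L2_set: "vec2norm v = L2_set (\<lambda>i. cmod (v $ i)) {..<dim_vec v}"
  by (simp add: vec2norm_def L2_set_def)

lemma vec2norm_eq_0_iff: "v \<in> carrier_vec n \<Longrightarrow> vec2norm v = 0 \<longleftrightarrow> v = 0\<^sub>v n"
  by (auto simp: vec2norm_L2_set L2_set_eq_0_iff)

lemma vec2norm_smult: "vec2norm (c \<cdot>\<^sub>v v) = cmod c * vec2norm v"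
  by (simp add: vec2norm_def norm_mult power_mult_distrib sum_distrib_left[symmetric]
      real_sqrt_mult)

lemma cscalar_prod_adjoint:
  fixes A :: "complex mat"
  assumes "A \<in> carrier_mat m n" "v \<in> carrier_vec n" "w \<in> carrier_vec m"
  shows "(A *\<^sub>v v) \<bullet>c w = v \<bullet>c (mat_adjoint A *\<^sub>v w)"
proof -
  have "(A *\<^sub>v v) \<bullet>c w = (\<Sum>i<m. \<Sum>j<n. A $$ (i, j) * v $ j * cnj (w $ i))"
    using assms by (simp add: scalar_prod_def atLeast0LessThan index_mult_vec_sum
        sum_distrib_right del: index_mult_mat_vec)
  also have "\<dots> = (\<Sum>j<n. \<Sum>i<m. A $$ (i, j) * v $ j * cnj (w $ i))"
    by (rule sum.swap)
  also have "\<dots> = v \<bullet>c (mat_adjoint A *\<^sub>v w)"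
    using assms by (simp add: scalar_prod_def atLeast0LessThan index_mult_vec_sum
        sum_distrib_left ac_simps del: index_mult_mat_vec)
  finally show ?thesis .
qed

section \<open>Unitary matrices and diagonalization of Hermitian matrices\<close>

lemma vec2norm_unitary:
  assumes U: "U \<in> carrier_mat n n" "mat_adjoint U * U = 1\<^sub>m n" and v: "v \<in> carrier_vec n"
  shows "vec2norm (U *\<^sub>v v) = vec2norm v"
proof -
  have "(U *\<^sub>v v) \<bullet>c (U *\<^sub>v v) = v \<bullet>c (mat_adjoint U *\<^sub>v (U *\<^sub>v v))"
    using U v by (intro cscalar_prod_adjoint) auto
  also have "mat_adjoint U *\<^sub>v (U *\<^sub>v v) = v"
    using U v by (simp flip: assoc_mult_mat_vec[of _ n n _ n])
  finally have "(vec2norm (U *\<^sub>v v))\<^sup>2 = (vec2norm v)\<^sup>2"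
    by (simp flip: vec2norm_square of_real_power)
  then show ?thesis by simp
qed

text \<open>Gram-Schmidt keeps the first vector of its input, so a basis that starts with
  \<open>v\<close> becomes an orthogonal one that still starts with \<open>v\<close>; normalizing
  its members gives the columns of \<open>W\<close>.\<close>

lemma unitary_completion:
  fixes v :: "complex vec"
  assumes v: "v \<in> carrier_vec n" "v \<noteq> 0\<^sub>v n"
  obtains W c where "W \<in> carrier_mat n n" "mat_adjoint W * W = 1\<^sub>m n"
    "col W 0 = c \<cdot>\<^sub>v v"
proof -
  interpret cof_vec_space n "TYPE(complex)" .
  have n: "n \<noteq> 0" using v by (auto intro: eq_vecI)
  define b where "b = basis_completion v"
  define ws where "ws = gram_schmidt n b"
  note bc = basis_completion[OF v, folded b_def]
  obtain vs where bv: "b = v # vs" using bc(6,7) n by (cases b) auto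
  have ws: "set ws \<subseteq> carrier_vec n" "corthogonal ws" "length ws = n"
    using gram_schmidt_result[OF bc(2,4,5) refl, folded ws_def] bc(6) by auto
  have hd: "ws ! 0 = v"
    using gram_schmidt_hd[OF v(1), of vs, folded bv] ws(3) n
    by (simp add: ws_def hd_conv_nth[symmetric] length_greater_0_conv[symmetric] del: length_greater_0_conv)
  have wsc: "ws ! i \<in> carrier_vec n" if "i < n" for i using ws that by auto
  define t where "t w = complex_of_real (1 / vec2norm w)" for w
  define W where "W = mat_of_cols n (map (\<lambda>w. t w \<cdot>\<^sub>v w) ws)"
  have W: "W \<in> carrier_mat n n" using ws by (auto simp: W_def)
  have col: "col W i = t (ws ! i) \<cdot>\<^sub>v (ws ! i)" if "i < n" for i
    using that ws wsc unfolding W_def by (subst col_mat_of_cols) auto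
  have "mat_adjoint W * W = 1\<^sub>m n"
  proof (rule eq_matI)
    fix i j assume "i < dim_row (1\<^sub>m n :: complex mat)" "j < dim_col (1\<^sub>m n :: complex mat)"
    then have ij: "i < n" "j < n" by auto
    have "(mat_adjoint W * W) $$ (i, j) = (\<Sum>k<n. cnj (col W i $ k) * col W j $ k)"
      using W ij by (simp add: index_mat_mult_sum del: index_mult_mat(1))
    also have "\<dots> = cnj (t (ws ! i)) * t (ws ! j) * ((ws ! j) \<bullet>c (ws ! i))"
      using ij wsc[OF ij(1)] wsc[OF ij(2)] by (simp add: col scalar_prod_def atLeast0LessThan sum_distrib_left ac_simps)
    also have "\<dots> = 1\<^sub>m n $$ (i, j)"
    proof (cases "i = j")
      case False
      then show ?thesis using corthogonalD[OF ws(2), of j i] ij ws(3) by auto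
    next
      case True
      \<comment> \<open>\<open>corthogonal\<close> includes that no member is orthogonal to itself,
        so dividing by the norm is legitimate.\<close>
      have "(ws ! j) \<bullet>c (ws ! j) \<noteq> 0" using corthogonalD[OF ws(2), of j j] ij ws(3) by auto
      then have "vec2norm (ws ! j) \<noteq> 0" by (simp flip: vec2norm_square)
      then show ?thesis using True ij
        by (simp flip: vec2norm_square add: t_def power2_eq_square)
    qed
    finally show "(mat_adjoint W * W) $$ (i, j) = 1\<^sub>m n $$ (i, j)" .
  qed (use W in auto)
  then show thesis using that[of W "t v"] W col[of 0] hd n by auto
qed

text \<open>Deflation: conjugating by a unitary matrix whose first column is an eigenvector splits
  off a 1 by 1 block, and the induction hypothesis applies to the remaining block, which is again
  Hermitian.\<close>

lemma hermitian_diagonalization: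
  fixes H :: "complex mat"
  assumes "H \<in> carrier_mat n n" "mat_adjoint H = H"
  obtains U D where "U \<in> carrier_mat n n" "mat_adjoint U * U = 1\<^sub>m n"
    "D \<in> carrier_mat n n" "diagonal_mat D" "H * U = U * D"
proof -
  have "\<exists>U D. U \<in> carrier_mat n n \<and> mat_adjoint U * U = 1\<^sub>m n \<and> D \<in> carrier_mat n n \<and>
      diagonal_mat D \<and> H * U = U * D"
    using assms
  proof (induction n arbitrary: H)
    case 0
    then show ?case
      by (intro exI[of _ "1\<^sub>m 0"]) (auto simp: diagonal_mat_def)
  next
    case (Suc n)
    note H = Suc.prems
    have "\<not> constant (poly (char_poly H))"
      by (simp add: constant_degree degree_monic_char_poly[OF H(1)])
    then obtain e where "poly (char_poly H) e = 0"
      using fundamental_theorem_of_algebra by blast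
    then obtain v where "eigenvector H v e"
      using eigenvalue_root_char_poly[OF H(1)] unfolding eigenvalue_def by blast
    then have v: "v \<in> carrier_vec (Suc n)" "v \<noteq> 0\<^sub>v (Suc n)" "H *\<^sub>v v = e \<cdot>\<^sub>v v"
      using H(1) unfolding eigenvector_def by auto
    obtain W c where W: "W \<in> carrier_mat (Suc n) (Suc n)" "mat_adjoint W * W = 1\<^sub>m (Suc n)"
        "col W 0 = c \<cdot>\<^sub>v v"
      using unitary_completion[OF v(1,2)] .
    have WW: "W * mat_adjoint W = 1\<^sub>m (Suc n)"
      using mat_mult_left_right_inverse[OF _ W(1,2)] W(1) by simp
    define K where "K = mat_adjoint W * (H * W)"
    have K: "K \<in> carrier_mat (Suc n) (Suc n)" using H W by (auto simp: K_def)
    have Kadj: "mat_adjoint K = K"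
      using H W by (simp add: K_def mat_adjoint_mult[of _ "Suc n" "Suc n" _ "Suc n"]
          assoc_mult_mat[of _ "Suc n" "Suc n" _ "Suc n" _ "Suc n"])
    have WK: "W * K = H * W"
    proof -
      have "W * K = (W * mat_adjoint W) * (H * W)"
        unfolding K_def using H W by (intro assoc_mult_mat[symmetric, of _ "Suc n" "Suc n" _ "Suc n" _ "Suc n"]) auto
      then show ?thesis using H W WW by simp
    qed
    have col0: "col K 0 = e \<cdot>\<^sub>v unit_vec (Suc n) 0"
    proof -
      have "col K 0 = mat_adjoint W *\<^sub>v (H *\<^sub>v col W 0)"
      proof -
        have "col K 0 = mat_adjoint W *\<^sub>v col (H * W) 0"
          unfolding K_def by (rule col_mult2[of _ "Suc n" "Suc n" _ "Suc n"]) (use H(1) W(1) in simp_all)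
        also have "col (H * W) 0 = H *\<^sub>v col W 0"
          by (rule col_mult2[of _ "Suc n" "Suc n" _ "Suc n"]) (use H(1) W(1) in simp_all)
        finally show ?thesis .
      qed
      also have "H *\<^sub>v col W 0 = e \<cdot>\<^sub>v col W 0"
        using H W v by (simp add: mult_mat_vec smult_smult_assoc mult.commute)
      also have "mat_adjoint W *\<^sub>v (e \<cdot>\<^sub>v col W 0) = e \<cdot>\<^sub>v (mat_adjoint W *\<^sub>v col W 0)"
        using W v by (intro mult_mat_vec) auto
      also have "mat_adjoint W *\<^sub>v col W 0 = col (mat_adjoint W * W) 0"
        using W by (subst col_mult2[of _ _ "Suc n"]) auto
      finally show ?thesis using W by simp
    qed
    have K0: "K $$ (i, 0) = (if i = 0 then e else 0)" if "i < Suc n" for i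
      using arg_cong[OF col0, of "\<lambda>v. v $ i"] K that by (simp add: unit_vec_def)
    \<comment> \<open>Symmetry turns the zeros of the first column into zeros of the first row, so
      \<open>K\<close> is block diagonal and not merely block triangular.\<close>
    have K0': "K $$ (0, i) = 0" if "i < n + 1" "i \<noteq> 0" for i
      using arg_cong[OF Kadj, of "\<lambda>M. M $$ (0, i)"] K K0[of i] that by simp
    define K3 where "K3 = mat n n (\<lambda>(i, j). K $$ (Suc i, Suc j))"
    have K3: "K3 \<in> carrier_mat n n" by (simp add: K3_def)
    have K3adj: "mat_adjoint K3 = K3"
    proof (rule eq_matI)
      fix i j assume "i < dim_row K3" "j < dim_col K3"
      then show "mat_adjoint K3 $$ (i, j) = K3 $$ (i, j)"
        using arg_cong[OF Kadj, of "\<lambda>M. M $$ (Suc i, Suc j)"] K by (simp add: K3_def)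
    qed (auto simp: K3_def)
    from Suc.IH[OF K3 K3adj] obtain V D where V: "V \<in> carrier_mat n n"
        "mat_adjoint V * V = 1\<^sub>m n" "D \<in> carrier_mat n n" "diagonal_mat D" "K3 * V = V * D"
      by blast
    let ?E = "mat 1 1 (\<lambda>_. e)"
    let ?Z = "0\<^sub>m 1 n :: complex mat" and ?Z' = "0\<^sub>m n 1 :: complex mat"
    have Kblock: "K = four_block_mat ?E ?Z ?Z' K3"
      using K K0 K0' by (intro eq_matI) (auto simp: K3_def)
    define V' where "V' = four_block_mat (1\<^sub>m 1) ?Z ?Z' V"
    define D' where "D' = four_block_mat ?E ?Z ?Z' D"
    have V': "V' \<in> carrier_mat (Suc n) (Suc n)" "D' \<in> carrier_mat (Suc n) (Suc n)"
      using four_block_carrier_mat[of "1\<^sub>m 1" 1 1 V n n ?Z ?Z'] V(1)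
        four_block_carrier_mat[of ?E 1 1 D n n ?Z ?Z'] V(3)
      unfolding V'_def D'_def by simp_all
    have adj_V': "mat_adjoint V' = four_block_mat (1\<^sub>m 1) ?Z ?Z' (mat_adjoint V)"
      using V(1) by (intro eq_matI) (auto simp: V'_def)
    have V'V': "mat_adjoint V' * V' = 1\<^sub>m (Suc n)"
    proof -
      have "mat_adjoint V' * V' = four_block_mat (1\<^sub>m 1) ?Z ?Z' (1\<^sub>m n)"
        unfolding adj_V' unfolding V'_def using V(1,2)
        by (subst mult_four_block_mat[of _ 1 1 _ n _ n _ _ 1 _ n]) simp_all
      then show ?thesis by simp
    qed
    have KV': "K * V' = V' * D'"
    proof -
      have "K * V' = four_block_mat ?E ?Z ?Z' (K3 * V)"
        unfolding V'_def Kblock using V(1) K3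
        by (subst mult_four_block_mat[of _ 1 1 _ n _ n _ _ 1 _ n]) simp_all
      moreover have "V' * D' = four_block_mat ?E ?Z ?Z' (V * D)"
        unfolding V'_def D'_def using V(1,3)
        by (subst mult_four_block_mat[of _ 1 1 _ n _ n _ _ 1 _ n]) simp_all
      ultimately show ?thesis using V(5) by simp
    qed
    have "diagonal_mat D'"
      using V(3,4) unfolding diagonal_mat_def D'_def by auto
    moreover have "mat_adjoint (W * V') * (W * V') = 1\<^sub>m (Suc n)"
    proof -
      have "mat_adjoint (W * V') * (W * V') = mat_adjoint V' * ((mat_adjoint W * W) * V')"
        using W(1) V' by (simp add: mat_adjoint_mult[of _ "Suc n" "Suc n" _ "Suc n"]
          assoc_mult_mat[of _ "Suc n" "Suc n" _ "Suc n" _ "Suc n"])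
      then show ?thesis using W V' V'V' by simp
    qed
    moreover have "H * (W * V') = (W * V') * D'"
    proof -
      have "H * (W * V') = (H * W) * V'"
        using H W V' by (simp add: assoc_mult_mat[of _ "Suc n" "Suc n" _ "Suc n" _ "Suc n"])
      also have "\<dots> = W * (K * V')"
        using K W V' by (simp flip: WK add: assoc_mult_mat[of _ "Suc n" "Suc n" _ "Suc n" _ "Suc n"])
      also have "\<dots> = (W * V') * D'"
        using K W V' by (simp add: KV' assoc_mult_mat[of _ "Suc n" "Suc n" _ "Suc n" _ "Suc n"])
      finally show ?thesis .
    qed
    ultimately show ?case
      using W V' by (intro exI[of _ "W * V'"] exI[of _ D']) auto
  qed
  then show thesis using that by blast
qed

section \<open>Bounds for singular values by test vectors\<close>

lemma homogeneous_system_nontrivial_solution: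
  fixes g :: "'i \<Rightarrow> nat \<Rightarrow> complex"
  assumes "finite I" "card I < k"
  obtains c where "\<exists>j<k. c j \<noteq> 0" "\<And>i. i \<in> I \<Longrightarrow> (\<Sum>j<k. g i j * c j) = 0"
proof -
  obtain h where h: "bij_betw h {0..<card I} I"
    using ex_bij_betw_nat_finite[OF assms(1)] by blast
  \<comment> \<open>The system is padded with zero equations to a square one and stored with
    equations as columns. Column \<open>k - 1\<close> is padding because \<open>card I < k\<close>,
    so the last unit vector shows that the determinant vanishes; the transposed matrix then has a
    nonzero kernel vector.\<close>
  define G where "G = mat k k (\<lambda>(j, r). if r < card I then g (h r) j else 0)"
  have G: "G \<in> carrier_mat k k" by (simp add: G_def)
  have "G *\<^sub>v unit_vec k (k - 1) = 0\<^sub>v k"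
    using assms(2) by (intro eq_vecI) (auto simp: G_def)
  moreover have "unit_vec k (k - 1) \<noteq> (0\<^sub>v k :: complex vec)"
    using assms(2) by auto
  ultimately have "det G = 0"
    using det_0_iff_vec_prod_zero[OF G] unit_vec_carrier by blast
  then have "det (transpose_mat G) = 0"
    using G by (simp add: det_transpose)
  then obtain v where v: "v \<in> carrier_vec k" "v \<noteq> 0\<^sub>v k" "transpose_mat G *\<^sub>v v = 0\<^sub>v k"
    using det_0_iff_vec_prod_zero[of "transpose_mat G" k] G by auto
  show thesis
  proof (rule that[of "\<lambda>j. v $ j"])
    show "\<exists>j<k. v $ j \<noteq> 0" using v by (metis carrier_vecD eq_vecI index_zero_vec)
    fix i assume "i \<in> I"
    then obtain r where r: "r < card I" "i = h r"
      using h unfolding bij_betw_def by (metis atLeastLessThan_iff image_iff)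
    have "(\<Sum>j<k. g i j * v $ j) = (transpose_mat G *\<^sub>v v) $ r"
      using r assms(2) v(1) by (simp add: index_mult_vec_sum G_def del: index_mult_mat_vec)
    then show "(\<Sum>j<k. g i j * v $ j) = 0"
      using v(3) r assms(2) by simp
  qed
qed

lemma proots_prod_linear_factors:
  "proots (\<Prod>a\<leftarrow>as. [:- a, 1:]) = mset (as :: 'a :: idom list)"
proof (induction as)
  case (Cons a as)
  have "(\<Prod>a\<leftarrow>as. [:- a, 1:]) \<noteq> 0" by (auto simp: prod_list_zero_iff)
  then show ?case using Cons by (simp add: proots_mult del: mult_pCons_left)
qed simp

lemma proots_char_poly_unitarily_diagonal:
  fixes H :: "complex mat"
  assumes "H \<in> carrier_mat n n" "U \<in> carrier_mat n n" "mat_adjoint U * U = 1\<^sub>m n"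
    "D \<in> carrier_mat n n" "diagonal_mat D" "H * U = U * D"
  shows "proots (char_poly H) = mset (map (\<lambda>i. D $$ (i, i)) [0..<n])"
proof -
  have UU: "U * mat_adjoint U = 1\<^sub>m n"
    using mat_mult_left_right_inverse[OF _ assms(2,3)] assms(2) by simp
  have "H = H * (U * mat_adjoint U)" using UU assms by simp
  also have "\<dots> = U * D * mat_adjoint U"
    using assms by (simp flip: assms(6) add: assoc_mult_mat[of _ n n _ n _ n])
  finally have "similar_mat_wit H D U (mat_adjoint U)"
    using assms UU by (intro similar_mat_witI[of _ _ n]) auto
  then have "char_poly H = char_poly D"
    by (intro char_poly_similar) (auto simp: similar_mat_def)
  also have "\<dots> = (\<Prod>a\<leftarrow>diag_mat D. [:- a, 1:])"
    using assms by (intro char_poly_upper_triangular) (auto simp: diagonal_mat_def)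
  finally show ?thesis
    using assms(4) by (simp only: proots_prod_linear_factors diag_mat_def carrier_matD)
qed

lemma L2_set_lincomb_le:
  fixes c :: "nat \<Rightarrow> complex"
  shows "L2_set (\<lambda>i. cmod (\<Sum>j<k. c j * u j i)) S \<le> (\<Sum>j<k. cmod (c j) * L2_set (\<lambda>i. cmod (u j i)) S)"
proof (induction k)
  case 0
  then show ?case by (simp add: L2_set_def)
next
  case (Suc k)
  have "L2_set (\<lambda>i. cmod (\<Sum>j<Suc k. c j * u j i)) S
      \<le> L2_set (\<lambda>i. cmod (\<Sum>j<k. c j * u j i) + cmod (c k) * cmod (u k i)) S"
    by (rule L2_set_mono) (auto simp: norm_mult intro: norm_triangle_ineq[THEN order_trans])
  also have "\<dots> \<le> L2_set (\<lambda>i. cmod (\<Sum>j<k. c j * u j i)) S + L2_set (\<lambda>i. cmod (c k) * cmod (u k i)) S"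
    by (rule L2_set_triangle_ineq)
  also have "\<dots> \<le> (\<Sum>j<Suc k. cmod (c j) * L2_set (\<lambda>i. cmod (u j i)) S)"
    using Suc by (simp add: L2_set_right_distrib)
  finally show ?case .
qed

text \<open>The min-max argument. If the \<open>k\<close>-th singular value exceeded
  \<open>k * \<eta>\<close>, fewer than \<open>k\<close> eigenvectors would belong to singular
  values up to this threshold, and some nonzero combination \<open>y\<close> of the
  \<open>w j\<close> would be orthogonal to all of them. Then \<open>A\<close> would stretch
  \<open>y\<close> by more than \<open>k * \<eta>\<close>, while the triangle inequality allows at
  most this factor.\<close>

lemma sing_val_le:
  assumes A: "A \<in> carrier_mat n n" and k: "1 \<le> k" "k \<le> n"
    and w: "\<And>j. j < k \<Longrightarrow> w j \<in> carrier_vec n"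
    and orth: "\<And>i j. i < k \<Longrightarrow> j < k \<Longrightarrow> w i \<bullet>c w j = (if i = j then 1 else 0)"
    and small: "\<And>j. j < k \<Longrightarrow> vec2norm (A *\<^sub>v w j) \<le> \<eta>"
  shows "sing_val k A \<le> real k * \<eta>"
proof (rule ccontr)
  assume large: "\<not> sing_val k A \<le> real k * \<eta>"
  define H where "H = mat_adjoint A * A"
  have H: "H \<in> carrier_mat n n" "mat_adjoint H = H"
    using A by (auto simp: H_def mat_adjoint_mult[of _ n n _ n])
  obtain U D where U: "U \<in> carrier_mat n n" "mat_adjoint U * U = 1\<^sub>m n"
      and D: "D \<in> carrier_mat n n" "diagonal_mat D" and HU: "H * U = U * D"
    using hermitian_diagonalization[OF H] .
  have UU: "U * mat_adjoint U = 1\<^sub>m n"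
    using mat_mult_left_right_inverse[OF _ U] U(1) by simp
  have \<eta>: "0 \<le> \<eta>" using small[of 0] k vec2norm_nonneg[of "A *\<^sub>v w 0"] by linarith
  define d where "d i = Re (D $$ (i, i))" for i
  define L where "L = sort (map (\<lambda>i. sqrt (d i)) [0..<n])"
  have "sing_val k A = L ! (k - 1)"
    unfolding sing_val_def H_def[symmetric]
      proots_char_poly_unitarily_diagonal[OF H(1) U D HU] L_def
    by (simp add: o_def d_def flip: mset_map del: mset_upt)
  then have Lk: "real k * \<eta> < L ! (k - 1)" using large by simp
  have L: "sorted L" "length L = n" by (simp_all add: L_def)
  define I where "I = {i. i < n \<and> sqrt (d i) \<le> real k * \<eta>}"
  \<comment> \<open>The count is done on the sorted list: its entry \<open>k - 1\<close> is the
    \<open>k\<close>-th singular value, so the entries from there on all exceed the threshold and at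
    most \<open>k - 1\<close> remain.\<close>
  have "card I = length (filter (\<lambda>i. sqrt (d i) \<le> real k * \<eta>) [0..<n])"
  proof -
    have "I = set (filter (\<lambda>i. sqrt (d i) \<le> real k * \<eta>) [0..<n])" by (auto simp: I_def)
    then show ?thesis by (simp only: distinct_card distinct_filter distinct_upt)
  qed
  also have "\<dots> = length (filter (\<lambda>x. x \<le> real k * \<eta>) (take (k - 1) L @ drop (k - 1) L))"
    by (simp add: L_def filter_sort filter_map o_def)
  also have "\<dots> = length (filter (\<lambda>x. x \<le> real k * \<eta>) (take (k - 1) L))"
  proof -
    have "\<not> x \<le> real k * \<eta>" if x: "x \<in> set (drop (k - 1) L)" for x
    proof -
      obtain i where "i < length (drop (k - 1) L)" "drop (k - 1) L ! i = x"
        using x by (meson in_set_conv_nth)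
      then have "k - 1 + i < n" "x = L ! (k - 1 + i)"
        using L(2) by auto
      then show ?thesis
        using Lk sorted_nth_mono[OF L(1), of "k - 1" "k - 1 + i"] L(2) by auto
    qed
    then show ?thesis by (simp del: append_take_drop_id)
  qed
  also have "\<dots> \<le> k - 1" by (rule order_trans[OF length_filter_le]) simp
  finally have "card I < k" using k by simp
  moreover have "finite I" by (simp add: I_def)
  \<comment> \<open>One equation for each index in \<open>I\<close>: the coordinate of the
    combination along that column of \<open>U\<close> has to vanish.\<close>
  ultimately obtain c where c: "\<exists>j<k. c j \<noteq> 0"
      "\<And>i. i \<in> I \<Longrightarrow> (\<Sum>j<k. (mat_adjoint U *\<^sub>v w j) $ i * c j) = 0"
    using homogeneous_system_nontrivial_solution[of I k "\<lambda>i j. (mat_adjoint U *\<^sub>v w j) $ i"] by metis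
  define y where "y = vec n (\<lambda>i. \<Sum>j<k. c j * w j $ i)"
  have y: "y \<in> carrier_vec n" by (simp add: y_def)
  have My: "(M *\<^sub>v y) $ i = (\<Sum>j<k. c j * (M *\<^sub>v w j) $ i)"
    if M: "M \<in> carrier_mat n n" and i: "i < n" for M i
  proof -
    have "(M *\<^sub>v y) $ i = (\<Sum>l<n. \<Sum>j<k. c j * (M $$ (i, l) * w j $ l))"
      using M i by (simp add: index_mult_vec_sum y_def sum_distrib_left ac_simps del: index_mult_mat_vec)
    also have "\<dots> = (\<Sum>j<k. \<Sum>l<n. c j * (M $$ (i, l) * w j $ l))"
      by (rule sum.swap)
    also have "\<dots> = (\<Sum>j<k. c j * (M *\<^sub>v w j) $ i)"
      using M i w by (intro sum.cong refl)
        (simp add: index_mult_vec_sum sum_distrib_left carrier_vecD[OF w] del: index_mult_mat_vec)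
    finally show ?thesis .
  qed
  define a where "a = mat_adjoint U *\<^sub>v y"
  have a: "a \<in> carrier_vec n" unfolding a_def by (rule mult_mat_vec_carrier[of _ n n]) (use U(1) y in auto)
  have a0: "a $ i = 0" if "i \<in> I" for i
    using c(2)[OF that] that U My[of "mat_adjoint U" i]
    by (simp add: a_def I_def mult.commute del: index_mult_mat_vec)
  have Ua: "U *\<^sub>v a = y"
    using U UU y by (simp add: a_def flip: assoc_mult_mat_vec[of _ n n _ n])
  have norm_y: "(vec2norm y)\<^sup>2 = (\<Sum>i<n. (cmod (a $ i))\<^sup>2)"
    using vec2norm_unitary[OF U a] a by (simp add: Ua vec2norm_def sum_nonneg)
  \<comment> \<open>Orthonormality of the \<open>w j\<close> gives Parseval's identity, so no
    coefficient exceeds \<open>vec2norm y\<close>; adding up \<open>k\<close> such terms is the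
    source of the factor \<open>k\<close>.\<close>
  have norm_yc: "(vec2norm y)\<^sup>2 = (\<Sum>j<k. (cmod (c j))\<^sup>2)"
  proof -
    have "complex_of_real ((vec2norm y)\<^sup>2) = (\<Sum>l<n. \<Sum>i<k. \<Sum>j<k. c i * cnj (c j) * (w i $ l * cnj (w j $ l)))"
      unfolding vec2norm_square
      by (simp add: scalar_prod_def atLeast0LessThan y_def sum_product ac_simps)
    also have "\<dots> = (\<Sum>i<k. \<Sum>j<k. \<Sum>l<n. c i * cnj (c j) * (w i $ l * cnj (w j $ l)))"
      by (subst sum.swap, rule sum.cong[OF refl], rule sum.swap)
    also have "\<dots> = (\<Sum>i<k. \<Sum>j<k. c i * cnj (c j) * (w i \<bullet>c w j))"
      by (intro sum.cong refl)
        (simp add: scalar_prod_def atLeast0LessThan sum_distrib_left carrier_vecD[OF w])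
    also have "\<dots> = (\<Sum>i<k. c i * cnj (c i))"
      by (simp add: orth if_distrib[of "\<lambda>x. _ * x"] sum.delta cong: if_cong)
    also have "\<dots> = complex_of_real (\<Sum>j<k. (cmod (c j))\<^sup>2)"
      by (simp add: complex_norm_square[unfolded of_real_power])
    finally show ?thesis by (simp only: of_real_eq_iff)
  qed
  have cle: "cmod (c j) \<le> vec2norm y" if "j < k" for j
  proof (rule power2_le_imp_le)
    show "(cmod (c j))\<^sup>2 \<le> (vec2norm y)\<^sup>2"
      unfolding norm_yc by (rule member_le_sum) (use that in auto)
  qed simp
  have "vec2norm y \<noteq> 0"
  proof
    assume "vec2norm y = 0"
    then have "c j = 0" if "j < k" for j using cle[OF that] by simp
    then show False using c(1) by blast
  qed
  have "vec2norm (A *\<^sub>v y) \<le> (\<Sum>j<k. cmod (c j) * vec2norm (A *\<^sub>v w j))"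
  proof -
    have "vec2norm (A *\<^sub>v y) = L2_set (\<lambda>i. cmod (\<Sum>j<k. c j * (A *\<^sub>v w j) $ i)) {..<n}"
      unfolding vec2norm_L2_set using A
      by (intro L2_set_cong) (simp_all add: My[OF A] del: index_mult_mat_vec)
    also have "\<dots> \<le> (\<Sum>j<k. cmod (c j) * vec2norm (A *\<^sub>v w j))"
      using L2_set_lincomb_le[where k = k and c = c and u = "\<lambda>j i. (A *\<^sub>v w j) $ i" and S = "{..<n}"] A
      by (simp add: vec2norm_L2_set del: index_mult_mat_vec)
    finally show ?thesis .
  qed
  also have "\<dots> \<le> (\<Sum>j<k. vec2norm y * \<eta>)"
    by (intro sum_mono mult_mono cle small) auto
  finally have upper: "(vec2norm (A *\<^sub>v y))\<^sup>2 \<le> (real k * \<eta>)\<^sup>2 * (vec2norm y)\<^sup>2"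
    by (simp flip: power_mult_distrib add: ac_simps power_mono)
  have Da: "(D *\<^sub>v a) $ i = D $$ (i, i) * a $ i" if "i < n" for i
  proof -
    have "(D *\<^sub>v a) $ i = (\<Sum>j<n. D $$ (i, j) * a $ j)"
      using D(1) a that by (simp add: index_mult_vec_sum del: index_mult_mat_vec)
    also have "\<dots> = (\<Sum>j<n. if j = i then D $$ (i, i) * a $ i else 0)"
      using D that by (intro sum.cong refl) (auto simp: diagonal_mat_def)
    finally show ?thesis using that by simp
  qed
  have "(A *\<^sub>v y) \<bullet>c (A *\<^sub>v y) = y \<bullet>c (H *\<^sub>v y)"
    using A y by (simp add: cscalar_prod_adjoint[of _ n n] H_def assoc_mult_mat_vec[of _ n n _ n])
  also have "H *\<^sub>v y = U *\<^sub>v (D *\<^sub>v a)"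
  proof -
    have "H *\<^sub>v y = (H * U) *\<^sub>v a"
      unfolding Ua[symmetric] by (rule assoc_mult_mat_vec[symmetric, of _ n n _ n]) (use H(1) U(1) a in auto)
    also have "\<dots> = U *\<^sub>v (D *\<^sub>v a)"
      unfolding HU by (rule assoc_mult_mat_vec[of _ n n _ n]) (use D(1) U(1) a in auto)
    finally show ?thesis .
  qed
  also have "y \<bullet>c (U *\<^sub>v (D *\<^sub>v a)) = a \<bullet>c (D *\<^sub>v a)"
    unfolding a_def using U(1) y mult_mat_vec_carrier[OF D(1) a]
    by (subst cscalar_prod_adjoint[of _ n n]) (simp_all add: a_def)
  finally have "complex_of_real ((vec2norm (A *\<^sub>v y))\<^sup>2) = a \<bullet>c (D *\<^sub>v a)"
    by (simp only: vec2norm_square)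
  then have "(vec2norm (A *\<^sub>v y))\<^sup>2 = Re (a \<bullet>c (D *\<^sub>v a))"
    by (metis Re_complex_of_real)
  also have "\<dots> = (\<Sum>i<n. Re (cnj (D $$ (i, i)) * (a $ i * cnj (a $ i))))"
    using D a by (simp add: scalar_prod_def atLeast0LessThan Da ac_simps del: index_mult_mat_vec)
  also have "\<dots> = (\<Sum>i<n. d i * (cmod (a $ i))\<^sup>2)"
    by (simp add: complex_norm_square[symmetric] d_def del: of_real_power)
  \<comment> \<open>In the eigenbasis only coordinates outside \<open>I\<close> survive, each
    weighted by more than the squared threshold. The inequality is strict because some coordinate is
    nonzero.\<close>
  also have "\<dots> > (\<Sum>i<n. (real k * \<eta>)\<^sup>2 * (cmod (a $ i))\<^sup>2)"
  proof (rule sum_strict_mono_ex1)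
    \<comment> \<open>Positivity of \<open>d i\<close> comes out here: \<open>sqrt\<close> is odd on
      the reals, so a positive root forces \<open>d i > 0\<close> and may be squared back.\<close>
    have dl: "(real k * \<eta>)\<^sup>2 < d i" if "i < n" "a $ i \<noteq> 0" for i
    proof -
      have "real k * \<eta> < sqrt (d i)"
        using that a0[of i] unfolding I_def by (metis (mono_tags, lifting) mem_Collect_eq not_le)
      moreover have "0 \<le> real k * \<eta>" using \<eta> by simp
      ultimately have "0 < sqrt (d i)" "(real k * \<eta>)\<^sup>2 < (sqrt (d i))\<^sup>2"
        by (linarith, intro power_strict_mono) auto
      then show ?thesis by simp
    qed
    show "\<forall>i\<in>{..<n}. (real k * \<eta>)\<^sup>2 * (cmod (a $ i))\<^sup>2 \<le> d i * (cmod (a $ i))\<^sup>2"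
    proof
      fix i assume "i \<in> {..<n}"
      then show "(real k * \<eta>)\<^sup>2 * (cmod (a $ i))\<^sup>2 \<le> d i * (cmod (a $ i))\<^sup>2"
        using dl[of i] by (cases "a $ i = 0") (auto intro!: mult_right_mono)
    qed
    have "\<exists>i<n. a $ i \<noteq> 0"
    proof (rule ccontr)
      assume "\<not> ?thesis"
      then have "(vec2norm y)\<^sup>2 = 0" by (simp add: norm_y)
      then show False using \<open>vec2norm y \<noteq> 0\<close> by simp
    qed
    then obtain i where "i < n" "a $ i \<noteq> 0" by blast
    then have "(real k * \<eta>)\<^sup>2 * (cmod (a $ i))\<^sup>2 < d i * (cmod (a $ i))\<^sup>2"
      by (intro mult_strict_right_mono dl) auto
    then show "\<exists>i\<in>{..<n}. (real k * \<eta>)\<^sup>2 * (cmod (a $ i))\<^sup>2 < d i * (cmod (a $ i))\<^sup>2"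
      using \<open>i < n\<close> by blast
  qed simp
  also have "(\<Sum>i<n. (real k * \<eta>)\<^sup>2 * (cmod (a $ i))\<^sup>2) = (real k * \<eta>)\<^sup>2 * (vec2norm y)\<^sup>2"
    by (simp add: norm_y sum_distrib_left)
  finally show False using upper by simp
qed

text \<open>Each singular value is the root of an eigenvalue \<open>z\<close> of
  \<open>mat_adjoint A * A\<close>, and on an eigenvector \<open>v\<close> for \<open>z\<close> the
  map \<open>A\<close> multiplies the squared norm by \<open>Re z\<close>. With
  \<open>\<delta> = 0\<close> the lemma yields that singular values are nonnegative.\<close>

lemma sing_val_ge:
  assumes A: "A \<in> carrier_mat n n" and k: "1 \<le> k" "k \<le> n" and "0 \<le> \<delta>"
    and ge: "\<And>v. v \<in> carrier_vec n \<Longrightarrow> \<delta> * vec2norm v \<le> vec2norm (A *\<^sub>v v)"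
  shows "\<delta> \<le> sing_val k A"
proof -
  define H where "H = mat_adjoint A * A"
  have H: "H \<in> carrier_mat n n" using A by (auto simp: H_def)
  define M where "M = proots (char_poly H)"
  have size: "size M = n"
    using degree_monic_char_poly[OF H] by (simp add: M_def size_proots_complex)
  have nz: "char_poly H \<noteq> 0" using degree_monic_char_poly[OF H] by auto
  \<comment> \<open>The characteristic polynomial has \<open>n\<close> complex roots with
    multiplicity, so position \<open>k - 1\<close> lies inside the list.\<close>
  have "sing_val k A \<in> set (sorted_list_of_multiset (image_mset (\<lambda>z. sqrt (Re z)) M))"
    unfolding sing_val_def H_def[symmetric] M_def[symmetric]
    by (rule nth_mem) (use k in \<open>simp flip: size_mset add: size\<close>)
  then obtain z where z: "z \<in># M" "sing_val k A = sqrt (Re z)" by auto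
  then have "poly (char_poly H) z = 0" using nz by (simp add: M_def)
  then obtain v where "eigenvector H v z"
    using eigenvalue_root_char_poly[OF H] unfolding eigenvalue_def by blast
  then have v: "v \<in> carrier_vec n" "v \<noteq> 0\<^sub>v n" "H *\<^sub>v v = z \<cdot>\<^sub>v v"
    using H unfolding eigenvector_def by auto
  have "(A *\<^sub>v v) \<bullet>c (A *\<^sub>v v) = v \<bullet>c (H *\<^sub>v v)"
    using A v by (simp add: cscalar_prod_adjoint[of _ n n] H_def assoc_mult_mat_vec[of _ n n _ n])
  also have "\<dots> = cnj z * complex_of_real ((vec2norm v)\<^sup>2)"
    unfolding v(3) vec2norm_square
    using v(1) by (simp add: scalar_prod_def sum_distrib_left ac_simps)
  finally have "(vec2norm (A *\<^sub>v v))\<^sup>2 = Re (cnj z * complex_of_real ((vec2norm v)\<^sup>2))"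
    by (metis Re_complex_of_real vec2norm_square)
  then have "(vec2norm (A *\<^sub>v v))\<^sup>2 = Re z * (vec2norm v)\<^sup>2" by simp
  moreover have "(\<delta> * vec2norm v)\<^sup>2 \<le> (vec2norm (A *\<^sub>v v))\<^sup>2"
    using ge[OF v(1)] \<open>0 \<le> \<delta>\<close> by (intro power_mono) auto
  moreover have "0 < (vec2norm v)\<^sup>2"
    using vec2norm_eq_0_iff[OF v(1)] v(2) by simp
  ultimately have "\<delta>\<^sup>2 \<le> Re z"
    by (simp add: power_mult_distrib)
  then show ?thesis using z(2) by (simp add: real_le_rsqrt)
qed

subsection \<open>Isometries along strictly increasing maps\<close>

lemma ell2_eqI: "(\<And>n. coord x n = coord y n) \<Longrightarrow> x = y"
  by (simp add: coord_inject[symmetric] fun_eq_iff)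

lemma blinfun_ell2_eqI:
  fixes A B :: "'a :: real_normed_vector \<Rightarrow>\<^sub>L ell2"
  shows "(\<And>x n. coord (A x) n = coord (B x) n) \<Longrightarrow> A = B"
  by (intro blinfun_eqI ell2_eqI)

text \<open>The adjoint of \<open>push_fun\<close> below. The test for \<open>strict_mono\<close>
  makes the lifting valid for every \<open>\<phi>\<close>: composition with a non-injective map can
  destroy square summability.\<close>

lift_definition pull_fun :: "(nat \<Rightarrow> nat) \<Rightarrow> ell2 \<Rightarrow> ell2" is
  "\<lambda>\<phi> x n. if strict_mono \<phi> then x (\<phi> n) else 0"
proof -
  fix \<phi> :: "nat \<Rightarrow> nat" and x :: "nat \<Rightarrow> complex"
  assume x: "summable (\<lambda>n. (cmod (x n))\<^sup>2)"
  show "summable (\<lambda>n. (cmod (if strict_mono \<phi> then x (\<phi> n) else 0))\<^sup>2)"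
    using summable_reindex[OF x, of \<phi>]
    by (cases "strict_mono \<phi>") (simp_all add: o_def strict_mono_imp_inj_on)
qed

lemma norm_pull_fun_le: "norm (pull_fun \<phi> x) \<le> norm x"
  using suminf_reindex_mono[OF summable_coord, of \<phi> x]
  by (cases "strict_mono \<phi>")
    (simp_all add: norm_ell2_eq pull_fun.rep_eq o_def strict_mono_imp_inj_on suminf_nonneg summable_coord)

lift_definition pull :: "(nat \<Rightarrow> nat) \<Rightarrow> ell2 \<Rightarrow>\<^sub>L ell2" is pull_fun
proof (rule bounded_linear_intro[where K = 1])
  fix \<phi> :: "nat \<Rightarrow> nat" and x y :: ell2 and r :: real
  show "pull_fun \<phi> (x + y) = pull_fun \<phi> x + pull_fun \<phi> y" by transfer auto
  show "pull_fun \<phi> (r *\<^sub>R x) = r *\<^sub>R pull_fun \<phi> x" by transfer auto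
  show "norm (pull_fun \<phi> x) \<le> norm x * 1" by (simp add: norm_pull_fun_le)
qed

text \<open>For strictly increasing \<open>\<phi>\<close> this sends the basis vector with index
  \<open>k\<close> to the one with index \<open>\<phi> k\<close>.\<close>

lift_definition push_fun :: "(nat \<Rightarrow> nat) \<Rightarrow> ell2 \<Rightarrow> ell2" is
  "\<lambda>\<phi> x n. if strict_mono \<phi> \<and> n \<in> range \<phi> then x (inv_into UNIV \<phi> n) else 0"
proof -
  fix \<phi> :: "nat \<Rightarrow> nat" and x :: "nat \<Rightarrow> complex"
  assume x: "summable (\<lambda>n. (cmod (x n))\<^sup>2)"
  let ?f = "\<lambda>n. (cmod (if strict_mono \<phi> \<and> n \<in> range \<phi> then x (inv_into UNIV \<phi> n) else 0))\<^sup>2"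
  show "summable ?f"
  proof (cases "strict_mono \<phi>")
    case True
    then show ?thesis
      using x summable_mono_reindex[of \<phi> ?f] by (simp add: strict_mono_imp_inj_on)
  qed simp
qed

lemma coord_push_fun:
  assumes "strict_mono \<phi>"
  shows "coord (push_fun \<phi> x) (\<phi> n) = coord x n"
    and "m \<notin> range \<phi> \<Longrightarrow> coord (push_fun \<phi> x) m = 0"
  using assms by (simp_all add: push_fun.rep_eq strict_mono_imp_inj_on)

lemma norm_push_fun_le: "norm (push_fun \<phi> x) \<le> norm x"
proof (cases "strict_mono \<phi>")
  case True
  then show ?thesis
    using suminf_mono_reindex[of \<phi> "\<lambda>n. (cmod (coord (push_fun \<phi> x) n))\<^sup>2"]
    by (simp add: norm_ell2_eq coord_push_fun)
qed (simp add: norm_ell2_eq push_fun.rep_eq suminf_nonneg summable_coord)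

lift_definition push :: "(nat \<Rightarrow> nat) \<Rightarrow> ell2 \<Rightarrow>\<^sub>L ell2" is push_fun
proof (rule bounded_linear_intro[where K = 1])
  fix \<phi> :: "nat \<Rightarrow> nat" and x y :: ell2 and r :: real
  show "push_fun \<phi> (x + y) = push_fun \<phi> x + push_fun \<phi> y" by transfer auto
  show "push_fun \<phi> (r *\<^sub>R x) = r *\<^sub>R push_fun \<phi> x" by transfer auto
  show "norm (push_fun \<phi> x) \<le> norm x * 1" by (simp add: norm_push_fun_le)
qed

lemma coord_pull: "strict_mono \<phi> \<Longrightarrow> coord (pull \<phi> x) n = coord x (\<phi> n)"
  by (simp add: pull.rep_eq pull_fun.rep_eq)

lemma coord_push:
  assumes "strict_mono \<phi>"
  shows "coord (push \<phi> x) (\<phi> n) = coord x n"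
    and "m \<notin> range \<phi> \<Longrightarrow> coord (push \<phi> x) m = 0"
  using coord_push_fun[OF assms] by (simp_all add: push.rep_eq)

lemma coord_cuntz_isometry:
  "coord (cuntz_isometry N i x) m = (if m mod N = i then coord x (m div N) else 0)"
  by (simp add: cuntz_isometry.rep_eq cuntz_fun.rep_eq)

lemma coord_proj: "coord (proj d x) n = (if n < d then coord x n else 0)"
  by (simp add: proj.rep_eq proj_fun.rep_eq)

lemma coord_scaleR: "coord (r *\<^sub>R x) n = complex_of_real r * coord x n"
  by (simp add: scaleR_ell2.rep_eq)

lemma coord_sum: "coord (sum f A) n = (\<Sum>a\<in>A. coord (f a) n)"
  by (induction A rule: infinite_finite_induct) (simp_all add: zero_ell2.rep_eq plus_ell2.rep_eq)

lemma coord_scalar_op: "coord (scalar_op c x) n = c * coord x n"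
  by (simp add: scalar_op.rep_eq scaleC_ell2.rep_eq)

lemma norm_pull: "norm (pull \<phi>) \<le> 1"
  by (rule norm_blinfun_bound) (simp_all add: pull.rep_eq norm_pull_fun_le)

lemma norm_push: "norm (push \<phi>) \<le> 1"
  by (rule norm_blinfun_bound) (simp_all add: push.rep_eq norm_push_fun_le)

lemma inner_push:
  assumes "strict_mono \<phi>"
  shows "inner (push \<phi> x) y = inner x (pull \<phi> y)"
  using suminf_mono_reindex[OF assms, of "\<lambda>n. Re (coord (push \<phi> x) n * cnj (coord y n))"]
  unfolding inner_ell2_sum by (simp add: coord_push[OF assms] coord_pull[OF assms])

text \<open>The relations of isometries with orthogonal ranges, from which \<open>spread\<close>
  will inherit that it is an isometry.\<close>

lemma pull_push:
  assumes "strict_mono \<phi>" "strict_mono \<psi>"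
  shows "pull \<phi> (push \<phi> x) = x"
    and "range \<phi> \<inter> range \<psi> = {} \<Longrightarrow> pull \<phi> (push \<psi> x) = 0"
  using assms by (auto intro!: ell2_eqI simp: coord_pull coord_push zero_ell2.rep_eq disjoint_iff)

subsection \<open>Inserting blocks of digits\<close>

text \<open>Reading natural numbers as base \<open>N\<close> words, lowest digit first, \<open>insert_block N p r c\<close>
  inserts the \<open>r\<close>-digit block \<open>c\<close> after the first \<open>p\<close> digits.\<close>

definition insert_block :: "nat \<Rightarrow> nat \<Rightarrow> nat \<Rightarrow> nat \<Rightarrow> nat \<Rightarrow> nat" where
  "insert_block N p r c k = k mod N ^ p + N ^ p * (c + N ^ r * (k div N ^ p))"

text \<open>Peeling off the lowest digit lowers the insertion point by one. As
  \<open>cuntz_isometry N i\<close> prepends the lowest digit \<open>i\<close>, this recursion is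
  the arithmetic behind its commutation rule with insertions.\<close>

lemma insert_block_Suc:
  "insert_block N (Suc p) r c k = k mod N + N * insert_block N p r c (k div N)"
  by (simp add: insert_block_def mod_mult2_eq div_mult2_eq algebra_simps)

lemma insert_block_Suc_mod: "insert_block N (Suc p) r c k mod N = k mod N"
  by (simp add: insert_block_Suc)

lemma insert_block_Suc_div:
  "N > 0 \<Longrightarrow> insert_block N (Suc p) r c k div N = insert_block N p r c (k div N)"
  by (simp add: insert_block_Suc)

lemma insert_block_div:
  "N > 0 \<Longrightarrow> insert_block N p r c k div N ^ p = c + N ^ r * (k div N ^ p)"
  by (simp add: insert_block_def)

lemma insert_block_div_mod:
  "N > 0 \<Longrightarrow> c < N ^ r \<Longrightarrow> insert_block N p r c k div N ^ p mod N ^ r = c"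
  by (simp add: insert_block_div)

text \<open>An insertion point within the first \<open>m\<close> digits lengthens
  \<open>m\<close>-digit words by exactly \<open>r\<close> digits: removing the lowest
  \<open>p + r\<close> digits afterwards leaves the same as removing \<open>p\<close> digits before.
  Being an equivalence, it makes insertion respect both range and kernel of the projections.\<close>

lemma insert_block_less_iff:
  assumes "N > 0" "c < N ^ r" "p \<le> m"
  shows "insert_block N p r c k < N ^ (m + r) \<longleftrightarrow> k < N ^ m"
proof -
  have "insert_block N p r c k < N ^ (m + r) \<longleftrightarrow> insert_block N p r c k div N ^ p div N ^ r < N ^ (m - p)"
    using assms by (simp add: div_less_iff_less_mult flip: div_mult2_eq power_add)
  also have "insert_block N p r c k div N ^ p div N ^ r = k div N ^ p"
    using assms by (simp add: insert_block_div)
  also have "k div N ^ p < N ^ (m - p) \<longleftrightarrow> k < N ^ m"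
    using assms by (simp add: div_less_iff_less_mult flip: power_add)
  finally show ?thesis .
qed

lemma strict_mono_insert_block:
  assumes "N > 0"
  shows "strict_mono (insert_block N p r c)"
proof (rule strict_monoI)
  fix i j :: nat assume "i < j"
  show "insert_block N p r c i < insert_block N p r c j"
  proof (cases "i div N ^ p = j div N ^ p")
    case True
    then have "i mod N ^ p < j mod N ^ p"
      using \<open>i < j\<close> by (metis div_mult_mod_eq nat_add_left_cancel_less)
    then show ?thesis using True by (simp add: insert_block_def)
  next
    case False
    then have "i div N ^ p < j div N ^ p"
      using \<open>i < j\<close> by (simp add: div_le_mono order_le_neq_trans)
    then have "insert_block N p r c i div N ^ p < insert_block N p r c j div N ^ p"
      using assms by (simp add: insert_block_div)
    then show ?thesis by (meson div_le_mono linorder_not_less)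
  qed
qed

lemma cuntz_push:
  assumes "N > 0"
  shows "cuntz_isometry N i o\<^sub>L push (insert_block N p r c)
    = push (insert_block N (Suc p) r c) o\<^sub>L cuntz_isometry N i"
proof (rule blinfun_ell2_eqI)
  fix x n
  note sm = strict_mono_insert_block[OF assms]
  show "coord ((cuntz_isometry N i o\<^sub>L push (insert_block N p r c)) x) n
    = coord ((push (insert_block N (Suc p) r c) o\<^sub>L cuntz_isometry N i) x) n"
  proof (cases "n \<in> range (insert_block N (Suc p) r c)")
    case True
    then obtain k where "n = insert_block N (Suc p) r c k" by blast
    then show ?thesis
      using assms by (simp add: coord_cuntz_isometry coord_push[OF sm] insert_block_Suc_mod insert_block_Suc_div)
  next
    case False
    \<comment> \<open>If \<open>n div N\<close> came from an insertion at \<open>p\<close>,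
      reattaching the lowest digit \<open>n mod N\<close> would exhibit \<open>n\<close> as an
      insertion at \<open>Suc p\<close>.\<close>
    have "n div N \<notin> range (insert_block N p r c)"
    proof
      assume "n div N \<in> range (insert_block N p r c)"
      then obtain k where "n div N = insert_block N p r c k" by blast
      then have "n = insert_block N (Suc p) r c (n mod N + N * k)"
        using assms by (simp add: insert_block_Suc) (metis mod_mult_div_eq)
      with False show False by blast
    qed
    then show ?thesis
      using False by (simp add: coord_cuntz_isometry coord_push[OF sm])
  qed
qed

text \<open>This is not the adjoint of \<open>cuntz_push\<close>. Its adjoint is the commutation
  rule of insertions with the adjoint of \<open>cuntz_isometry N i\<close>, which also belongs to
  the algebra.\<close>

lemma pull_cuntz:
  assumes "N > 0"
  shows "pull (insert_block N (Suc p) r c) o\<^sub>L cuntz_isometry N i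
    = cuntz_isometry N i o\<^sub>L pull (insert_block N p r c)"
  by (rule blinfun_ell2_eqI)
    (use assms in \<open>simp add: coord_cuntz_isometry coord_pull strict_mono_insert_block
      insert_block_Suc_mod insert_block_Suc_div\<close>)

lemma proj_push:
  assumes "N > 0" "c < N ^ r" "p \<le> m"
  shows "proj (N ^ (m + r)) o\<^sub>L push (insert_block N p r c) = push (insert_block N p r c) o\<^sub>L proj (N ^ m)"
proof (rule blinfun_ell2_eqI)
  fix x n
  note sm = strict_mono_insert_block[OF assms(1)]
  show "coord ((proj (N ^ (m + r)) o\<^sub>L push (insert_block N p r c)) x) n
    = coord ((push (insert_block N p r c) o\<^sub>L proj (N ^ m)) x) n"
  proof (cases "n \<in> range (insert_block N p r c)")
    case True
    then show ?thesis
      by (auto simp: coord_proj coord_push[OF sm] insert_block_less_iff[OF assms])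
  next
    case False
    then show ?thesis
      by (simp add: coord_proj coord_push[OF sm])
  qed
qed

lemma pull_proj:
  assumes "N > 0" "c < N ^ r" "p \<le> m"
  shows "pull (insert_block N p r c) o\<^sub>L proj (N ^ (m + r)) = proj (N ^ m) o\<^sub>L pull (insert_block N p r c)"
  by (rule blinfun_ell2_eqI)
    (simp add: coord_proj coord_pull strict_mono_insert_block assms insert_block_less_iff)

text \<open>A block \<open>1 0\<^sup>m y\<close> does not overlap a shift of such a block by at most \<open>m\<close> digits.\<close>

definition marker :: "nat \<Rightarrow> nat \<Rightarrow> nat \<Rightarrow> nat \<Rightarrow> bool" where
  "marker N m r c \<longleftrightarrow> m < r \<and> c < N ^ r \<and> c mod N ^ Suc m = 1"

text \<open>Compare the digits at position \<open>q\<close>, counted from 0. On the right it is the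
  lowest digit of a marker, hence 1. On the left it is digit \<open>q - p\<close> of a marker, and
  the digits 1 to \<open>m\<close> of a marker are 0.\<close>

lemma insert_marker_neq_shift:
  assumes N: "N \<ge> 2" and c: "marker N m r c" "marker N m r c'" and pq: "p < q" "q \<le> m"
  shows "insert_block N p r c k \<noteq> insert_block N q r c' k'"
proof -
  define t where "t = q - p"
  have t: "q = p + t" "0 < t" "t \<le> m" "t < r" using pq c by (auto simp: t_def marker_def)
  define y where "y = c div N ^ Suc m"
  have N0: "N > 0" using N by simp
  have "insert_block N p r c k div N ^ q = (c + N ^ r * (k div N ^ p)) div N ^ t"
    using N0 by (simp add: t(1) power_add div_mult2_eq insert_block_div)
  \<comment> \<open>As \<open>t < r\<close>, the digits above the block start beyond position
    \<open>q\<close> and contribute a multiple of \<open>N\<close> after the division.\<close>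
  also have "N ^ r * (k div N ^ p) = N ^ t * (N * (N ^ (r - Suc t) * (k div N ^ p)))"
    using t(4) by (simp flip: power_add mult.assoc power_Suc add: Suc_diff_Suc)
  also have "(c + \<dots>) div N ^ t = c div N ^ t + N * (N ^ (r - Suc t) * (k div N ^ p))"
    using N0 by simp
  also have "c div N ^ t = N * (N ^ (m - t) * y)"
  proof -
    have "c = 1 + N ^ Suc m * y"
      using c(1) unfolding y_def by (metis marker_def mod_mult_div_eq)
    also have "N ^ Suc m = N ^ t * (N * N ^ (m - t))"
      using t(3) by (simp flip: power_add power_Suc)
    finally have "c = 1 + N ^ t * (N * N ^ (m - t) * y)"
      by (simp only: mult.assoc)
    then have "c div N ^ t = (1 + N ^ t * (N * N ^ (m - t) * y)) div N ^ t"
      by simp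
    also have "\<dots> = N * N ^ (m - t) * y"
    proof -
      have "1 div N ^ t = 0" using N t(2) by (intro div_less one_less_power) auto
      moreover have "N ^ t \<noteq> 0" using N by simp
      ultimately show ?thesis by (subst div_mult_self2) auto
    qed
    finally show ?thesis by (simp add: mult.assoc)
  qed
  finally have "insert_block N p r c k div N ^ q mod N = 0" by simp
  moreover have "insert_block N q r c' k' div N ^ q mod N = 1"
  proof -
    have "c' mod N = 1"
      using c(2) N mod_mod_cancel[of N "N ^ Suc m" c'] by (auto simp: marker_def)
    moreover have "N dvd N ^ r * (k' div N ^ q)" using t(4) by (simp add: dvd_power)
    ultimately show ?thesis
      using N by (simp add: insert_block_div mod_add_eq[symmetric])
  qed
  ultimately show ?thesis by auto
qed

text \<open>Different insertion points are separated by the marker digits; at equal points the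
  inserted block can be read off the result.\<close>

lemma disjoint_range_insert_marker:
  assumes "N \<ge> 2" "marker N m r c" "marker N m r c'" "p < m" "q < m" "p \<noteq> q \<or> c \<noteq> c'"
  shows "range (insert_block N p r c) \<inter> range (insert_block N q r c') = {}"
proof -
  have "insert_block N p r c k \<noteq> insert_block N q r c' k'" for k k'
  proof (cases p q rule: linorder_cases)
    case less
    then show ?thesis using insert_marker_neq_shift[of N m r c c' p q] assms by simp
  next
    case greater
    then have "insert_block N q r c' k' \<noteq> insert_block N p r c k"
      using assms by (intro insert_marker_neq_shift[of N m r c' c q p]) simp_all
    then show ?thesis by simp
  next
    case equal
    then show ?thesis
      using assms insert_block_div_mod[of N c r p k] insert_block_div_mod[of N c' r q k']
      by (auto simp: marker_def)
  qed
  then show ?thesis by blast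
qed

section \<open>Averaged insertions and their adjoints\<close>

definition spread :: "nat \<Rightarrow> nat \<Rightarrow> nat \<Rightarrow> nat \<Rightarrow> ell2 \<Rightarrow>\<^sub>L ell2" where
  "spread N m r c = (1 / sqrt m) *\<^sub>R (\<Sum>p<m. push (insert_block N p r c))"

definition spread_adj :: "nat \<Rightarrow> nat \<Rightarrow> nat \<Rightarrow> nat \<Rightarrow> ell2 \<Rightarrow>\<^sub>L ell2" where
  "spread_adj N m r c = (1 / sqrt m) *\<^sub>R (\<Sum>p<m. pull (insert_block N p r c))"

lemma spread_apply: "spread N m r c x = (1 / sqrt m) *\<^sub>R (\<Sum>p<m. push (insert_block N p r c) x)"
  by (simp add: spread_def blinfun.scaleR_left blinfun.sum_left)

lemma spread_adj_apply: "spread_adj N m r c x = (1 / sqrt m) *\<^sub>R (\<Sum>p<m. pull (insert_block N p r c) x)"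
  by (simp add: spread_adj_def blinfun.scaleR_left blinfun.sum_left)

lemma inner_spread: "N > 0 \<Longrightarrow> inner (spread N m r c x) y = inner x (spread_adj N m r c y)"
  by (simp add: spread_apply spread_adj_apply inner_sum_left inner_sum_right inner_push
      strict_mono_insert_block)

text \<open>Of the \<open>m * m\<close> products, the off-diagonal ones vanish by disjointness of
  the ranges; the \<open>m\<close> diagonal ones give \<open>x\<close> each, which the two factors
  \<open>1 / sqrt m\<close> average.\<close>

lemma spread_adj_spread:
  assumes "N \<ge> 2" "marker N m r c" "m > 0"
  shows "spread_adj N m r c (spread N m r c x) = x"
proof -
  have sm: "strict_mono (insert_block N p r c)" for p
    using assms(1) by (simp add: strict_mono_insert_block)
  have "pull (insert_block N p r c) (push (insert_block N q r c) x) = (if p = q then x else 0)"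
    if "p < m" "q < m" for p q
    using pull_push[OF sm sm] disjoint_range_insert_marker[of N m r c c p q] that assms by auto
  then show ?thesis
    using assms(3) by (simp add: spread_apply spread_adj_apply blinfun.scaleR_right blinfun.sum_right
        scaleR_sum_right[symmetric] sum_constant_scaleR cong: sum.cong_simp)
qed

lemma norm_spread_apply:
  assumes "N \<ge> 2" "marker N m r c" "m > 0"
  shows "norm (spread N m r c x) = norm x"
  using assms by (simp add: norm_eq_sqrt_inner inner_spread spread_adj_spread)

text \<open>Orthogonality in a form that survives truncation to finitely many coordinates: images
  for different blocks have disjoint supports.\<close>

lemma coord_spread_disjoint:
  assumes "N \<ge> 2" "marker N m r c" "marker N m r c'" "c \<noteq> c'"
  shows "coord (spread N m r c x) n = 0 \<or> coord (spread N m r c' y) n = 0"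
proof (rule ccontr)
  assume nz: "\<not> ?thesis"
  have N0: "N > 0" using assms by simp
  have "\<exists>p<m. n \<in> range (insert_block N p r c)" if "coord (spread N m r c x) n \<noteq> 0" for c x
  proof (rule ccontr)
    assume "\<not> ?thesis"
    then have "coord (spread N m r c x) n = 0"
      by (simp add: spread_apply coord_scaleR coord_sum coord_push[OF strict_mono_insert_block[OF N0]])
    then show False using that by simp
  qed
  then obtain p q where "p < m" "q < m" "n \<in> range (insert_block N p r c)"
      "n \<in> range (insert_block N q r c')"
    using nz by metis
  then show False
    using disjoint_range_insert_marker[OF assms(1-3), of p q] assms(4) by blast
qed

lemma norm_spread_le:
  assumes "N \<ge> 2" "marker N m r c"
  shows "norm (spread N m r c) \<le> 1"
proof (cases "m > 0")
  case True
  show ?thesis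
    by (rule norm_blinfun_bound) (simp_all add: norm_spread_apply[OF assms True])
qed (simp add: spread_def)

section \<open>Contractions and adjoint pairs\<close>

lemma norm_cuntz_isometry: "norm (cuntz_isometry N i) \<le> 1"
proof (rule norm_blinfun_bound)
  fix x
  have "(\<Sum>m. (cmod (coord (cuntz_fun N i x) m))\<^sup>2) \<le> (\<Sum>n. (cmod (coord x n))\<^sup>2)"
    unfolding cuntz_fun.rep_eq
    by (intro suminf_le_const summable_cuntz cuntz_partial_sum_le summable_coord)
  then show "norm (cuntz_isometry N i x) \<le> 1 * norm x"
    by (simp add: norm_ell2_eq cuntz_isometry.rep_eq)
qed simp

lemma norm_proj: "norm (proj d) \<le> 1"
proof (rule norm_blinfun_bound)
  fix x
  show "norm (proj d x) \<le> 1 * norm x"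
    unfolding norm_ell2_eq mult_1_left
    by (intro real_sqrt_le_mono suminf_le summable_coord) (simp add: coord_proj)
qed simp

text \<open>A relation between two given operators, so that no existence theorem for adjoints is
  called upon; the real inner product suffices to transfer norm bounds.\<close>

definition real_adjoint :: "('a :: real_inner \<Rightarrow>\<^sub>L 'b :: real_inner) \<Rightarrow> ('b \<Rightarrow>\<^sub>L 'a) \<Rightarrow> bool" where
  "real_adjoint A B \<longleftrightarrow> (\<forall>x y. inner (A x) y = inner x (B y))"

lemma real_adjoint_sym: "real_adjoint A B \<Longrightarrow> real_adjoint B A"
  unfolding real_adjoint_def by (metis inner_commute)

lemma real_adjoint_compose:
  "real_adjoint A B \<Longrightarrow> real_adjoint C D \<Longrightarrow> real_adjoint (A o\<^sub>L C) (D o\<^sub>L B)"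
  by (simp add: real_adjoint_def)

lemma real_adjoint_diff:
  "real_adjoint A B \<Longrightarrow> real_adjoint C D \<Longrightarrow> real_adjoint (A - C) (B - D)"
  by (simp add: real_adjoint_def blinfun.diff_left inner_diff_left inner_diff_right)

lemma norm_real_adjoint_le:
  assumes "real_adjoint A B"
  shows "norm B \<le> norm A"
proof (rule norm_blinfun_bound)
  fix y
  have "norm (B y) * norm (B y) = inner (A (B y)) y"
    using assms by (simp add: real_adjoint_def power2_norm_eq_inner flip: power2_eq_square)
  also have "\<dots> \<le> norm (A (B y)) * norm y"
    by (rule norm_cauchy_schwarz)
  also have "\<dots> \<le> (norm A * norm (B y)) * norm y"
    by (intro mult_right_mono norm_blinfun) auto
  finally have "norm (B y) * norm (B y) \<le> norm (B y) * (norm A * norm y)"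
    by (simp add: ac_simps)
  then show "norm (B y) \<le> norm A * norm y"
    by (cases "norm (B y) = 0") (auto simp: mult_le_cancel_left)
qed simp

lemma is_adjoint_real_adjoint: "is_adjoint A B \<Longrightarrow> real_adjoint A B"
  by (simp add: is_adjoint_def real_adjoint_def inner_ell2_def)

lemma real_adjoint_spread: "N > 0 \<Longrightarrow> real_adjoint (spread N m r c) (spread_adj N m r c)"
  by (simp add: real_adjoint_def inner_spread)

lemma norm_spread_adj_le:
  assumes "N \<ge> 2" "marker N m r c"
  shows "norm (spread_adj N m r c) \<le> 1"
  using norm_real_adjoint_le[OF real_adjoint_spread, of N m r c] norm_spread_le[OF assms] assms
  by simp

subsection \<open>Asymptotic intertwiners of the spreading isometries\<close>

text \<open>Constant sequences represent single operators, so that sections \<open>P\<^sub>n A P\<^sub>n\<close> are covered by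
  closure under products.  The second bound is the first one for the adjoint sequence, stated
  without presupposing that adjoints exist.\<close>

definition asymp_intertwining :: "nat \<Rightarrow> (nat \<Rightarrow> ell2 \<Rightarrow>\<^sub>L ell2) \<Rightarrow> bool" where
  "asymp_intertwining N X \<longleftrightarrow> (\<forall>\<epsilon>>0. \<forall>\<^sub>F m in sequentially. \<forall>r c. marker N m r c \<longrightarrow>
     norm ((X (m + r) o\<^sub>L spread N m r c) - (spread N m r c o\<^sub>L X m)) \<le> \<epsilon> \<and>
     norm ((spread_adj N m r c o\<^sub>L X (m + r)) - (X m o\<^sub>L spread_adj N m r c)) \<le> \<epsilon>)"

lemma asymp_intertwiningI:
  assumes "\<And>\<epsilon>. 0 < \<epsilon> \<Longrightarrow> \<forall>\<^sub>F m in sequentially. \<forall>r c. marker N m r c \<longrightarrow>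
     norm ((X (m + r) o\<^sub>L spread N m r c) - (spread N m r c o\<^sub>L X m)) \<le> \<epsilon> \<and>
     norm ((spread_adj N m r c o\<^sub>L X (m + r)) - (X m o\<^sub>L spread_adj N m r c)) \<le> \<epsilon>"
  shows "asymp_intertwining N X"
  using assms by (simp add: asymp_intertwining_def)

lemma asymp_intertwiningD:
  assumes "asymp_intertwining N X" "0 < \<epsilon>"
  shows "\<forall>\<^sub>F m in sequentially. \<forall>r c. marker N m r c \<longrightarrow>
     norm ((X (m + r) o\<^sub>L spread N m r c) - (spread N m r c o\<^sub>L X m)) \<le> \<epsilon> \<and>
     norm ((spread_adj N m r c o\<^sub>L X (m + r)) - (X m o\<^sub>L spread_adj N m r c)) \<le> \<epsilon>"
  using assms by (simp add: asymp_intertwining_def)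

lemmas blinfun_compose_diff =
  bounded_bilinear.diff_left[OF bounded_bilinear_blinfun_compose]
  bounded_bilinear.diff_right[OF bounded_bilinear_blinfun_compose]

lemmas blinfun_compose_add =
  bounded_bilinear.add_left[OF bounded_bilinear_blinfun_compose]
  bounded_bilinear.add_right[OF bounded_bilinear_blinfun_compose]

lemma blinfun_compose_assoc: "(A o\<^sub>L B) o\<^sub>L C = A o\<^sub>L (B o\<^sub>L C)"
  by (rule blinfun_eqI) simp

lemma norm_blinfun_compose_le:
  "norm A \<le> a \<Longrightarrow> norm B \<le> b \<Longrightarrow> norm (A o\<^sub>L B) \<le> a * b"
  by (rule order_trans[OF norm_blinfun_compose])
    (meson mult_mono norm_ge_zero order_trans)

lemma asymp_intertwining_exact:
  assumes "\<And>m r c. marker N m r c \<Longrightarrow> X (m + r) o\<^sub>L spread N m r c = spread N m r c o\<^sub>L X m"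
    and "\<And>m r c. marker N m r c \<Longrightarrow> spread_adj N m r c o\<^sub>L X (m + r) = X m o\<^sub>L spread_adj N m r c"
  shows "asymp_intertwining N X"
  by (rule asymp_intertwiningI) (simp add: assms)

lemma asymp_intertwining_add:
  assumes "asymp_intertwining N X" "asymp_intertwining N Y"
  shows "asymp_intertwining N (\<lambda>n. X n + Y n)"
proof (rule asymp_intertwiningI)
  fix \<epsilon> :: real assume "0 < \<epsilon>"
  then have "0 < \<epsilon> / 2" by simp
  from asymp_intertwiningD[OF assms(1) this] asymp_intertwiningD[OF assms(2) this]
  show "\<forall>\<^sub>F m in sequentially. \<forall>r c. marker N m r c \<longrightarrow>
     norm (((X (m + r) + Y (m + r)) o\<^sub>L spread N m r c) - (spread N m r c o\<^sub>L (X m + Y m))) \<le> \<epsilon> \<and>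
     norm ((spread_adj N m r c o\<^sub>L (X (m + r) + Y (m + r))) - ((X m + Y m) o\<^sub>L spread_adj N m r c)) \<le> \<epsilon>"
  proof eventually_elim
    case (elim m)
    show ?case
    proof (intro allI impI conjI)
      fix r c assume "marker N m r c"
      note e = elim(1)[rule_format, OF this] elim(2)[rule_format, OF this]
      let ?F = "spread N m r c" and ?G = "spread_adj N m r c"
      have "((X (m + r) + Y (m + r)) o\<^sub>L ?F) - (?F o\<^sub>L (X m + Y m))
          = ((X (m + r) o\<^sub>L ?F) - (?F o\<^sub>L X m)) + ((Y (m + r) o\<^sub>L ?F) - (?F o\<^sub>L Y m))"
        by (simp add: blinfun_compose_add)
      also have "norm \<dots> \<le> \<epsilon> / 2 + \<epsilon> / 2"
        using e by (intro norm_triangle_le add_mono) auto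
      finally show "norm (((X (m + r) + Y (m + r)) o\<^sub>L ?F) - (?F o\<^sub>L (X m + Y m))) \<le> \<epsilon>" by simp
      have "(?G o\<^sub>L (X (m + r) + Y (m + r))) - ((X m + Y m) o\<^sub>L ?G)
          = ((?G o\<^sub>L X (m + r)) - (X m o\<^sub>L ?G)) + ((?G o\<^sub>L Y (m + r)) - (Y m o\<^sub>L ?G))"
        by (simp add: blinfun_compose_add)
      also have "norm \<dots> \<le> \<epsilon> / 2 + \<epsilon> / 2"
        using e by (intro norm_triangle_le add_mono) auto
      finally show "norm ((?G o\<^sub>L (X (m + r) + Y (m + r))) - ((X m + Y m) o\<^sub>L ?G)) \<le> \<epsilon>" by simp
    qed
  qed
qed

text \<open>The commutator obeys a Leibniz rule, so each error gets multiplied by a bound on the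
  other factor, and this bound has to be uniform in \<open>n\<close>.\<close>

lemma asymp_intertwining_compose:
  assumes X: "asymp_intertwining N X" "\<And>n. norm (X n) \<le> K"
    and Y: "asymp_intertwining N Y" "\<And>n. norm (Y n) \<le> L"
  shows "asymp_intertwining N (\<lambda>n. X n o\<^sub>L Y n)"
proof (rule asymp_intertwiningI)
  fix \<epsilon> :: real assume "0 < \<epsilon>"
  have K: "0 \<le> K" "0 \<le> L" using X(2) Y(2) norm_ge_zero order_trans by blast+
  \<comment> \<open>The summand 1 keeps the denominator positive when both bounds are 0.\<close>
  define \<delta> where "\<delta> = \<epsilon> / (K + L + 1)"
  have \<delta>: "0 < \<delta>" using \<open>0 < \<epsilon>\<close> K by (simp add: \<delta>_def)
  have \<delta>': "K * \<delta> + \<delta> * L \<le> \<epsilon>"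
  proof -
    have "K * \<delta> + \<delta> * L \<le> (K + L + 1) * \<delta>" using \<delta> by (simp add: algebra_simps)
    then show ?thesis using K by (simp add: \<delta>_def)
  qed
  from asymp_intertwiningD[OF X(1) \<delta>] asymp_intertwiningD[OF Y(1) \<delta>]
  show "\<forall>\<^sub>F m in sequentially. \<forall>r c. marker N m r c \<longrightarrow>
     norm (((X (m + r) o\<^sub>L Y (m + r)) o\<^sub>L spread N m r c) - (spread N m r c o\<^sub>L (X m o\<^sub>L Y m))) \<le> \<epsilon> \<and>
     norm ((spread_adj N m r c o\<^sub>L (X (m + r) o\<^sub>L Y (m + r))) - ((X m o\<^sub>L Y m) o\<^sub>L spread_adj N m r c)) \<le> \<epsilon>"
  proof eventually_elim
    case (elim m)
    show ?case
    proof (intro allI impI conjI)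
      fix r c assume "marker N m r c"
      note e = elim(1)[rule_format, OF this] elim(2)[rule_format, OF this]
      let ?F = "spread N m r c" and ?G = "spread_adj N m r c"
      have "((X (m + r) o\<^sub>L Y (m + r)) o\<^sub>L ?F) - (?F o\<^sub>L (X m o\<^sub>L Y m))
          = (X (m + r) o\<^sub>L ((Y (m + r) o\<^sub>L ?F) - (?F o\<^sub>L Y m)))
          + (((X (m + r) o\<^sub>L ?F) - (?F o\<^sub>L X m)) o\<^sub>L Y m)"
        by (simp add: blinfun_compose_diff blinfun_compose_assoc)
      also have "norm \<dots> \<le> K * \<delta> + \<delta> * L"
        using e X(2) Y(2) by (intro norm_triangle_le add_mono norm_blinfun_compose_le) auto
      also note \<delta>'
      finally show "norm (((X (m + r) o\<^sub>L Y (m + r)) o\<^sub>L ?F) - (?F o\<^sub>L (X m o\<^sub>L Y m))) \<le> \<epsilon>" .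
      have "(?G o\<^sub>L (X (m + r) o\<^sub>L Y (m + r))) - ((X m o\<^sub>L Y m) o\<^sub>L ?G)
          = (X m o\<^sub>L ((?G o\<^sub>L Y (m + r)) - (Y m o\<^sub>L ?G)))
          + (((?G o\<^sub>L X (m + r)) - (X m o\<^sub>L ?G)) o\<^sub>L Y (m + r))"
        by (simp add: blinfun_compose_diff blinfun_compose_assoc)
      also have "norm \<dots> \<le> K * \<delta> + \<delta> * L"
        using e X(2) Y(2) by (intro norm_triangle_le add_mono norm_blinfun_compose_le) auto
      also note \<delta>'
      finally show "norm ((?G o\<^sub>L (X (m + r) o\<^sub>L Y (m + r))) - ((X m o\<^sub>L Y m) o\<^sub>L ?G)) \<le> \<epsilon>" .
    qed
  qed
qed

text \<open>Three errors of a third each, using that \<open>spread\<close> and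
  \<open>spread_adj\<close> are contractions. The approximation is uniform in \<open>n\<close>
  because \<open>X\<close> occurs both at \<open>m\<close> and at \<open>m + r\<close> with
  unrestricted \<open>r\<close>.\<close>

lemma asymp_intertwining_limit:
  assumes "N \<ge> 2"
    and lim: "\<And>\<epsilon>. 0 < \<epsilon> \<Longrightarrow> \<exists>Y. asymp_intertwining N Y \<and> (\<forall>n. norm (X n - Y n) \<le> \<epsilon>)"
  shows "asymp_intertwining N X"
proof (rule asymp_intertwiningI)
  fix \<epsilon> :: real assume "0 < \<epsilon>"
  then have \<epsilon>: "0 < \<epsilon> / 3" by simp
  obtain Y where Y: "asymp_intertwining N Y" "\<And>n. norm (X n - Y n) \<le> \<epsilon> / 3"
    using lim[OF \<epsilon>] by blast
  have Y': "norm (Y n - X n) \<le> \<epsilon> / 3" for n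
    using Y(2)[of n] by (simp add: norm_minus_commute)
  from asymp_intertwiningD[OF Y(1) \<epsilon>]
  show "\<forall>\<^sub>F m in sequentially. \<forall>r c. marker N m r c \<longrightarrow>
     norm ((X (m + r) o\<^sub>L spread N m r c) - (spread N m r c o\<^sub>L X m)) \<le> \<epsilon> \<and>
     norm ((spread_adj N m r c o\<^sub>L X (m + r)) - (X m o\<^sub>L spread_adj N m r c)) \<le> \<epsilon>"
  proof eventually_elim
    case (elim m)
    show ?case
    proof (intro allI impI conjI)
      fix r c assume a: "marker N m r c"
      note e = elim[rule_format, OF a]
      note F = norm_spread_le[OF assms(1) a] norm_spread_adj_le[OF assms(1) a]
      let ?F = "spread N m r c" and ?G = "spread_adj N m r c"
      have "(X (m + r) o\<^sub>L ?F) - (?F o\<^sub>L X m)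
          = ((Y (m + r) o\<^sub>L ?F) - (?F o\<^sub>L Y m)) + ((X (m + r) - Y (m + r)) o\<^sub>L ?F) + (?F o\<^sub>L (Y m - X m))"
        by (simp add: blinfun_compose_diff)
      also have "norm \<dots> \<le> \<epsilon> / 3 + \<epsilon> / 3 * 1 + 1 * (\<epsilon> / 3)"
        using e F Y(2) Y' by (intro norm_triangle_le add_mono norm_blinfun_compose_le) auto
      finally show "norm ((X (m + r) o\<^sub>L ?F) - (?F o\<^sub>L X m)) \<le> \<epsilon>" by simp
      have "(?G o\<^sub>L X (m + r)) - (X m o\<^sub>L ?G)
          = ((?G o\<^sub>L Y (m + r)) - (Y m o\<^sub>L ?G)) + ((Y m - X m) o\<^sub>L ?G) + (?G o\<^sub>L (X (m + r) - Y (m + r)))"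
        by (simp add: blinfun_compose_diff)
      also have "norm \<dots> \<le> \<epsilon> / 3 + \<epsilon> / 3 * 1 + 1 * (\<epsilon> / 3)"
        using e F Y(2) Y' by (intro norm_triangle_le add_mono norm_blinfun_compose_le) auto
      finally show "norm ((?G o\<^sub>L X (m + r)) - (X m o\<^sub>L ?G)) \<le> \<epsilon>" by simp
    qed
  qed
qed

text \<open>Taking adjoints exchanges the two bounds: the error of \<open>Y\<close> with
  \<open>spread\<close> is the adjoint of the error of \<open>X\<close> with
  \<open>spread_adj\<close>, and vice versa.\<close>

lemma asymp_intertwining_adjoint:
  assumes "N > 0" "asymp_intertwining N X" and adj: "\<And>n. real_adjoint (X n) (Y n)"
  shows "asymp_intertwining N Y"
proof (rule asymp_intertwiningI)
  fix \<epsilon> :: real assume "0 < \<epsilon>"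
  from asymp_intertwiningD[OF assms(2) this]
  show "\<forall>\<^sub>F m in sequentially. \<forall>r c. marker N m r c \<longrightarrow>
     norm ((Y (m + r) o\<^sub>L spread N m r c) - (spread N m r c o\<^sub>L Y m)) \<le> \<epsilon> \<and>
     norm ((spread_adj N m r c o\<^sub>L Y (m + r)) - (Y m o\<^sub>L spread_adj N m r c)) \<le> \<epsilon>"
  proof eventually_elim
    case (elim m)
    show ?case
    proof (intro allI impI conjI)
      fix r c assume "marker N m r c"
      note e = elim[rule_format, OF this]
      let ?F = "spread N m r c" and ?G = "spread_adj N m r c"
      note F = real_adjoint_spread[OF assms(1), of m r c]
      have "real_adjoint ((?G o\<^sub>L X (m + r)) - (X m o\<^sub>L ?G)) ((Y (m + r) o\<^sub>L ?F) - (?F o\<^sub>L Y m))"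
        by (intro real_adjoint_diff real_adjoint_compose adj F real_adjoint_sym[OF F])
      then show "norm ((Y (m + r) o\<^sub>L ?F) - (?F o\<^sub>L Y m)) \<le> \<epsilon>"
        using norm_real_adjoint_le e order_trans by blast
      have "real_adjoint ((X (m + r) o\<^sub>L ?F) - (?F o\<^sub>L X m)) ((?G o\<^sub>L Y (m + r)) - (Y m o\<^sub>L ?G))"
        by (intro real_adjoint_diff real_adjoint_compose adj F real_adjoint_sym[OF F])
      then show "norm ((?G o\<^sub>L Y (m + r)) - (Y m o\<^sub>L ?G)) \<le> \<epsilon>"
        using norm_real_adjoint_le e order_trans by blast
    qed
  qed
qed

text \<open>The operator space is only a real vector space, so complex scaling enters as composition
  with \<open>scalar_op c\<close> and is then covered by the product rule.\<close>

lemma asymp_intertwining_scalar: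
  "N > 0 \<Longrightarrow> asymp_intertwining N (\<lambda>_. scalar_op c)"
  by (rule asymp_intertwining_exact; rule blinfun_ell2_eqI)
    (simp_all add: coord_scalar_op spread_apply spread_adj_apply coord_scaleR coord_sum
      coord_pull strict_mono_insert_block push.rep_eq push_fun.rep_eq sum_distrib_left ac_simps
      if_distrib[of "\<lambda>x. c * x"] cong: if_cong)

lemma proj_spread:
  assumes "N > 0" "marker N m r c"
  shows "proj (N ^ (m + r)) o\<^sub>L spread N m r c = spread N m r c o\<^sub>L proj (N ^ m)"
proof (rule blinfun_eqI)
  fix x
  have c: "c < N ^ r" using assms(2) by (simp add: marker_def)
  have "proj (N ^ (m + r)) (push (insert_block N p r c) x) = push (insert_block N p r c) (proj (N ^ m) x)"
    if "p < m" for p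
    using arg_cong[OF proj_push[OF assms(1) c, of p m], of "\<lambda>A. blinfun_apply A x"] that by simp
  then show "(proj (N ^ (m + r)) o\<^sub>L spread N m r c) x = (spread N m r c o\<^sub>L proj (N ^ m)) x"
    by (simp add: spread_apply blinfun.scaleR_right blinfun.sum_right)
qed

lemma spread_adj_proj:
  assumes "N > 0" "marker N m r c"
  shows "spread_adj N m r c o\<^sub>L proj (N ^ (m + r)) = proj (N ^ m) o\<^sub>L spread_adj N m r c"
proof (rule blinfun_eqI)
  fix x
  have c: "c < N ^ r" using assms(2) by (simp add: marker_def)
  have "pull (insert_block N p r c) (proj (N ^ (m + r)) x) = proj (N ^ m) (pull (insert_block N p r c) x)"
    if "p < m" for p
    using arg_cong[OF pull_proj[OF assms(1) c, of p m], of "\<lambda>A. blinfun_apply A x"] that by simp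
  then show "(spread_adj N m r c o\<^sub>L proj (N ^ (m + r))) x = (proj (N ^ m) o\<^sub>L spread_adj N m r c) x"
    by (simp add: spread_adj_apply blinfun.scaleR_right blinfun.sum_right)
qed

lemma asymp_intertwining_proj: "N > 0 \<Longrightarrow> asymp_intertwining N (\<lambda>n. proj (N ^ n))"
  by (rule asymp_intertwining_exact) (simp_all add: proj_spread spread_adj_proj)

text \<open>\<^term>\<open>cuntz_isometry N i\<close> moves an inserted block up by one digit, so the commutator with
  the sum over all insertion points telescopes.\<close>

lemma asymp_intertwining_cuntz:
  assumes "N \<ge> 2"
  shows "asymp_intertwining N (\<lambda>_. cuntz_isometry N i)"
proof (rule asymp_intertwiningI)
  fix \<epsilon> :: real assume "0 < \<epsilon>"
  let ?S = "cuntz_isometry N i"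
  have N0: "N > 0" using assms by simp
  \<comment> \<open>Only two boundary terms of norm at most 1 remain, so the bound is uniform in
    \<open>r\<close> and \<open>c\<close>.\<close>
  have bound: "norm ((?S o\<^sub>L spread N m r c) - (spread N m r c o\<^sub>L ?S)) \<le> 1 / sqrt m * 2 \<and>
      norm ((spread_adj N m r c o\<^sub>L ?S) - (?S o\<^sub>L spread_adj N m r c)) \<le> 1 / sqrt m * 2" for m r c
  proof
    let ?J = "\<lambda>p. push (insert_block N p r c)" and ?J' = "\<lambda>p. pull (insert_block N p r c)"
    have 1: "norm (?J p o\<^sub>L ?S) \<le> 1" "norm (?J' p o\<^sub>L ?S) \<le> 1" for p
      using norm_blinfun_compose_le[OF norm_push norm_cuntz_isometry]
        norm_blinfun_compose_le[OF norm_pull norm_cuntz_isometry] by simp_all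
    have "(?S o\<^sub>L spread N m r c) - (spread N m r c o\<^sub>L ?S)
        = (1 / sqrt m) *\<^sub>R (\<Sum>p<m. (?S o\<^sub>L ?J p) - (?J p o\<^sub>L ?S))"
      by (rule blinfun_eqI) (simp add: spread_apply blinfun.diff_left blinfun.scaleR_left
          blinfun.sum_left blinfun.scaleR_right blinfun.sum_right sum_subtractf scaleR_diff_right)
    also have "\<dots> = (1 / sqrt m) *\<^sub>R ((?J m o\<^sub>L ?S) - (?J 0 o\<^sub>L ?S))"
      unfolding cuntz_push[OF N0]
      by (simp only: sum_lessThan_telescope[of "\<lambda>p. ?J p o\<^sub>L ?S" m])
    also have "norm \<dots> \<le> 1 / sqrt m * 2"
      unfolding norm_scaleR using norm_triangle_le_diff[of "?J m o\<^sub>L ?S" "?J 0 o\<^sub>L ?S" 2] 1(1)[of m] 1(1)[of 0]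
      by (intro mult_mono) auto
    finally show "norm ((?S o\<^sub>L spread N m r c) - (spread N m r c o\<^sub>L ?S)) \<le> 1 / sqrt m * 2" .
    \<comment> \<open>In this commutator the term that \<open>pull_cuntz\<close> shifts is the
      subtracted one, hence the leading minus sign.\<close>
    have "(spread_adj N m r c o\<^sub>L ?S) - (?S o\<^sub>L spread_adj N m r c)
        = - ((1 / sqrt m) *\<^sub>R (\<Sum>p<m. (?S o\<^sub>L ?J' p) - (?J' p o\<^sub>L ?S)))"
      by (rule blinfun_eqI) (simp add: spread_adj_apply blinfun.diff_left blinfun.scaleR_left blinfun.minus_left
          blinfun.sum_left blinfun.scaleR_right blinfun.sum_right sum_subtractf scaleR_diff_right)
    also have "\<dots> = - ((1 / sqrt m) *\<^sub>R ((?J' m o\<^sub>L ?S) - (?J' 0 o\<^sub>L ?S)))"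
      unfolding pull_cuntz[OF N0, symmetric]
      by (simp only: sum_lessThan_telescope[of "\<lambda>p. ?J' p o\<^sub>L ?S" m])
    also have "norm \<dots> \<le> 1 / sqrt m * 2"
      unfolding norm_scaleR norm_minus_cancel
      using norm_triangle_le_diff[of "?J' m o\<^sub>L ?S" "?J' 0 o\<^sub>L ?S" 2] 1(2)[of m] 1(2)[of 0]
      by (intro mult_mono) auto
    finally show "norm ((spread_adj N m r c o\<^sub>L ?S) - (?S o\<^sub>L spread_adj N m r c)) \<le> 1 / sqrt m * 2" .
  qed
  have "(\<lambda>m. 1 / sqrt (real m) * 2) \<longlonglongrightarrow> 0"
    by (intro tendsto_mult_left_zero tendsto_divide_0[OF tendsto_const] filterlim_at_top_imp_at_infinity
        filterlim_compose[OF sqrt_at_top filterlim_real_sequentially])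
  then have "\<forall>\<^sub>F m in sequentially. 1 / sqrt (real m) * 2 < \<epsilon>"
    using \<open>0 < \<epsilon>\<close> by (rule order_tendstoD)
  then show "\<forall>\<^sub>F m in sequentially. \<forall>r c. marker N m r c \<longrightarrow>
      norm ((?S o\<^sub>L spread N m r c) - (spread N m r c o\<^sub>L ?S)) \<le> \<epsilon> \<and>
      norm ((spread_adj N m r c o\<^sub>L ?S) - (?S o\<^sub>L spread_adj N m r c)) \<le> \<epsilon>"
    by eventually_elim (use bound in \<open>meson less_imp_le order_trans\<close>)
qed

subsection \<open>Matrices as operators\<close>

lemma norm_ell2_finite_support:
  assumes "\<And>i. d \<le> i \<Longrightarrow> coord x i = 0"
  shows "norm x = L2_set (\<lambda>i. cmod (coord x i)) {..<d}"
  unfolding norm_ell2_eq L2_set_def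
  by (subst suminf_finite[of "{..<d}"]) (use assms in auto)

lemma inner_ell2_finite_support:
  assumes "\<And>i. d \<le> i \<Longrightarrow> coord x i = 0 \<or> coord y i = 0"
  shows "inner x y = Re (\<Sum>i<d. coord x i * cnj (coord y i))"
proof -
  have "Re (coord x i * cnj (coord y i)) = 0" if "i \<notin> {..<d}" for i
    using assms[of i] that by auto
  then show ?thesis
    unfolding inner_ell2_sum Re_sum by (intro suminf_finite) auto
qed

lemma norm_coord_sum_le: "L2_set (\<lambda>i. cmod (coord x i)) {..<d} \<le> norm x"
  unfolding norm_ell2_eq L2_set_def
  by (intro real_sqrt_le_mono sum_le_suminf summable_coord) auto

lemma norm_coord_le: "cmod (coord x i) \<le> norm x"
proof -
  have "cmod (coord x i) \<le> L2_set (\<lambda>i. cmod (coord x i)) {..<Suc i}"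
    by (rule member_le_L2_set) auto
  also note norm_coord_sum_le
  finally show ?thesis .
qed

lift_definition vec_ell2 :: "complex vec \<Rightarrow> ell2" is "\<lambda>v i. if i < dim_vec v then v $ i else 0"
  by (rule summable_finite[of "{..<dim_vec _}"]) auto

lemma norm_vec_ell2: "norm (vec_ell2 v) = vec2norm v"
  by (subst norm_ell2_finite_support[of "dim_vec v"])
    (auto simp: vec_ell2.rep_eq vec2norm_L2_set intro: L2_set_cong)

lemma vec_coord_vec_ell2: "v \<in> carrier_vec d \<Longrightarrow> vec d (coord (vec_ell2 v)) = v"
  by (intro eq_vecI) (auto simp: vec_ell2.rep_eq)

text \<open>Extending matrices by zero puts all sizes on one Hilbert space, where they can be
  composed with the spreading isometries.\<close>

lift_definition mat_op_fun :: "complex mat \<Rightarrow> ell2 \<Rightarrow> ell2" is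
  "\<lambda>M x i. if i < dim_row M then \<Sum>j<dim_col M. M $$ (i, j) * x j else 0"
  by (rule summable_finite[of "{..<dim_row _}"]) auto

lift_definition mat_op :: "complex mat \<Rightarrow> ell2 \<Rightarrow>\<^sub>L ell2" is mat_op_fun
proof (rule bounded_linear_intro)
  fix M :: "complex mat" and x y :: ell2 and r :: real
  show "mat_op_fun M (x + y) = mat_op_fun M x + mat_op_fun M y"
    by transfer (auto simp: algebra_simps sum.distrib)
  show "mat_op_fun M (r *\<^sub>R x) = r *\<^sub>R mat_op_fun M x"
    by transfer (auto simp: sum_distrib_left ac_simps)
  have "norm (mat_op_fun M x) = L2_set (\<lambda>i. cmod (coord (mat_op_fun M x) i)) {..<dim_row M}"
    by (rule norm_ell2_finite_support) (simp add: mat_op_fun.rep_eq)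
  also have "\<dots> \<le> (\<Sum>i<dim_row M. cmod (coord (mat_op_fun M x) i))"
    by (rule L2_set_le_sum) simp
  also have "\<dots> \<le> (\<Sum>i<dim_row M. \<Sum>j<dim_col M. norm x * cmod (M $$ (i, j)))"
    by (intro sum_mono)
      (auto simp: mat_op_fun.rep_eq norm_mult mult.commute intro!: order_trans[OF norm_sum] sum_mono
        mult_right_mono norm_coord_le)
  finally show "norm (mat_op_fun M x) \<le> norm x * (\<Sum>i<dim_row M. \<Sum>j<dim_col M. cmod (M $$ (i, j)))"
    by (simp add: sum_distrib_left)
qed

lemma coord_mat_op:
  "coord (mat_op M x) i = (if i < dim_row M then \<Sum>j<dim_col M. M $$ (i, j) * coord x j else 0)"
  by (simp add: mat_op.rep_eq mat_op_fun.rep_eq)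

lemma norm_mat_op_apply: "norm (mat_op M x) = vec2norm (M *\<^sub>v vec (dim_col M) (coord x))"
proof -
  have "norm (mat_op M x) = L2_set (\<lambda>i. cmod (coord (mat_op M x) i)) {..<dim_row M}"
    by (rule norm_ell2_finite_support) (simp add: coord_mat_op)
  also have "\<dots> = vec2norm (M *\<^sub>v vec (dim_col M) (coord x))"
    unfolding vec2norm_L2_set
    by (intro L2_set_cong) (simp_all add: coord_mat_op index_mult_vec_sum del: index_mult_mat_vec)
  finally show ?thesis .
qed

lemma vec2norm_mult_le_norm_mat_op:
  assumes "v \<in> carrier_vec (dim_col M)"
  shows "vec2norm (M *\<^sub>v v) \<le> norm (mat_op M) * vec2norm v"
  using norm_blinfun[of "mat_op M" "vec_ell2 v"]
  by (simp add: norm_mat_op_apply norm_vec_ell2 vec_coord_vec_ell2[OF assms])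

text \<open>Cutting \<open>x\<close> down to its first \<open>dim_col M\<close> coordinates does not
  change its image and does not increase its norm, so finite vectors already determine the operator
  norm.\<close>

lemma norm_mat_op: "norm (mat_op M) = mat_opnorm M"
proof -
  let ?S = "{vec2norm (M *\<^sub>v v) |v. v \<in> carrier_vec (dim_col M) \<and> vec2norm v \<le> 1}"
  have ub: "s \<le> norm (mat_op M)" if s: "s \<in> ?S" for s
  proof -
    obtain v where v: "s = vec2norm (M *\<^sub>v v)" "v \<in> carrier_vec (dim_col M)" "vec2norm v \<le> 1"
      using s by blast
    have "s \<le> norm (mat_op M) * vec2norm v"
      unfolding v(1) by (rule vec2norm_mult_le_norm_mat_op[OF v(2)])
    also have "\<dots> \<le> norm (mat_op M)" using v(3) by (simp add: mult_left_le)
    finally show ?thesis .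
  qed
  then have bdd: "bdd_above ?S" by (rule bdd_aboveI)
  \<comment> \<open>A real \<open>Sup\<close> is meaningful only for a nonempty set that is bounded
    above; the zero vector supplies a member.\<close>
  have "vec2norm (M *\<^sub>v 0\<^sub>v (dim_col M)) \<in> ?S"
    by (auto simp: vec2norm_def intro!: exI[of _ "0\<^sub>v (dim_col M)"])
  then have ne: "?S \<noteq> {}" and pos: "0 \<le> Sup ?S"
    using cSup_upper[OF _ bdd] vec2norm_nonneg order_trans by blast+
  show ?thesis unfolding mat_opnorm_def
  proof (rule antisym)
    show "Sup ?S \<le> norm (mat_op M)" using cSup_least[OF ne] ub by blast
    show "norm (mat_op M) \<le> Sup ?S"
    proof (rule norm_blinfun_bound[OF pos])
      fix x
      define w where "w = vec (dim_col M) (coord x)"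
      have w: "w \<in> carrier_vec (dim_col M)" by (simp add: w_def)
      have wx: "vec2norm w \<le> norm x"
        using norm_coord_sum_le[of x "dim_col M"]
        by (simp add: w_def vec2norm_L2_set cong: L2_set_cong_simp)
      have "vec2norm (M *\<^sub>v w) \<le> Sup ?S * vec2norm w"
      proof (cases "vec2norm w = 0")
        case True
        then show ?thesis using vec2norm_mult_le_norm_mat_op[OF w] by simp
      next
        case False
        define u where "u = complex_of_real (1 / vec2norm w) \<cdot>\<^sub>v w"
        have "vec2norm (M *\<^sub>v u) \<in> ?S"
          using w False by (auto simp: u_def vec2norm_smult norm_divide intro!: exI[of _ u])
        then have "vec2norm (M *\<^sub>v u) \<le> Sup ?S" by (rule cSup_upper[OF _ bdd])
        moreover have "M *\<^sub>v u = complex_of_real (1 / vec2norm w) \<cdot>\<^sub>v (M *\<^sub>v w)"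
          unfolding u_def by (rule mult_mat_vec[of _ "dim_row M" "dim_col M"]) (use w in auto)
        then have "vec2norm (M *\<^sub>v u) = vec2norm (M *\<^sub>v w) / vec2norm w"
          by (simp add: vec2norm_smult norm_divide)
        ultimately show ?thesis
          using False by (simp add: divide_le_eq less_le)
      qed
      also have "\<dots> \<le> Sup ?S * norm x" using wx pos by (rule mult_left_mono)
      finally show "norm (mat_op M x) \<le> Sup ?S * norm x"
        by (simp add: norm_mat_op_apply w_def)
    qed
  qed
qed

lemma mat_op_add:
  "A \<in> carrier_mat m n \<Longrightarrow> B \<in> carrier_mat m n \<Longrightarrow> mat_op (A + B) = mat_op A + mat_op B"
  by (rule blinfun_ell2_eqI)
    (auto simp: coord_mat_op blinfun.add_left plus_ell2.rep_eq algebra_simps sum.distrib)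

lemma mat_op_diff:
  "A \<in> carrier_mat m n \<Longrightarrow> B \<in> carrier_mat m n \<Longrightarrow> mat_op (A - B) = mat_op A - mat_op B"
  by (rule blinfun_ell2_eqI)
    (auto simp: coord_mat_op blinfun.diff_left minus_ell2.rep_eq algebra_simps sum_subtractf)

lemma mat_op_smult: "mat_op (c \<cdot>\<^sub>m A) = scalar_op c o\<^sub>L mat_op A"
  by (rule blinfun_ell2_eqI)
    (auto simp: coord_mat_op coord_scalar_op sum_distrib_left ac_simps)

lemma mat_op_zero: "mat_op (0\<^sub>m m n) = 0"
  by (rule blinfun_ell2_eqI) (auto simp: coord_mat_op zero_ell2.rep_eq)

lemma mat_op_mult:
  assumes "A \<in> carrier_mat m n" "B \<in> carrier_mat n k"
  shows "mat_op (A * B) = mat_op A o\<^sub>L mat_op B"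
proof (rule blinfun_ell2_eqI)
  fix x i
  have "(\<Sum>j<k. (A * B) $$ (i, j) * coord x j) = (\<Sum>l<n. A $$ (i, l) * (\<Sum>j<k. B $$ (l, j) * coord x j))"
    if "i < m"
  proof -
    have "(\<Sum>j<k. (A * B) $$ (i, j) * coord x j) = (\<Sum>j<k. \<Sum>l<n. A $$ (i, l) * B $$ (l, j) * coord x j)"
      using assms that
      by (intro sum.cong refl) (simp add: index_mat_mult_sum sum_distrib_right del: index_mult_mat(1))
    also have "\<dots> = (\<Sum>l<n. \<Sum>j<k. A $$ (i, l) * B $$ (l, j) * coord x j)"
      by (rule sum.swap)
    finally show ?thesis by (simp add: sum_distrib_left mult.assoc)
  qed
  then show "coord (mat_op (A * B) x) i = coord ((mat_op A o\<^sub>L mat_op B) x) i"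
    using assms by (simp add: coord_mat_op del: index_mult_mat(1))
qed

lemma real_adjoint_mat_op: "real_adjoint (mat_op A) (mat_op (mat_adjoint A))"
  unfolding real_adjoint_def
proof (intro allI)
  fix x y
  have "inner (mat_op A x) y
      = Re (\<Sum>i<dim_row A. \<Sum>j<dim_col A. A $$ (i, j) * coord x j * cnj (coord y i))"
    by (subst inner_ell2_finite_support[of "dim_row A"])
      (auto simp: coord_mat_op sum_distrib_right intro!: sum.cong)
  also have "\<dots> = Re (\<Sum>j<dim_col A. \<Sum>i<dim_row A. A $$ (i, j) * coord x j * cnj (coord y i))"
    by (subst sum.swap) simp
  also have "\<dots> = inner x (mat_op (mat_adjoint A) y)"
    by (subst inner_ell2_finite_support[of "dim_col A"])
      (auto simp: coord_mat_op sum_distrib_left ac_simps intro!: sum.cong)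
  finally show "inner (mat_op A x) y = inner x (mat_op (mat_adjoint A) y)" .
qed

text \<open>The matrix records only the images of the unit vectors, and \<open>proj d x\<close> is a
  complex combination of these; this is where complex linearity of \<open>A\<close> enters.\<close>

lemma mat_op_section_mat:
  assumes "A \<in> bounded_ops"
  shows "mat_op (section_mat d A) = proj d o\<^sub>L A o\<^sub>L proj d"
proof (rule blinfun_ell2_eqI)
  fix x i
  have px: "proj d x = (\<Sum>j<d. scaleC_ell2 (coord x j) (unit_ell2 j))"
    by (rule ell2_eqI)
      (auto simp: coord_proj coord_sum scaleC_ell2.rep_eq unit_ell2.rep_eq if_distrib[of "\<lambda>z. _ * z"]
        cong: if_cong)
  have pu: "proj d (unit_ell2 j) = unit_ell2 j" if "j < d" for j
    using that by (intro ell2_eqI) (auto simp: coord_proj unit_ell2.rep_eq)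
  have "coord (A (proj d x)) i = (\<Sum>j<d. coord x j * coord (A (unit_ell2 j)) i)"
    using assms unfolding px blinfun.sum_right coord_sum
    by (simp add: bounded_ops_def scaleC_ell2.rep_eq)
  then show "coord (mat_op (section_mat d A) x) i = coord ((proj d o\<^sub>L A o\<^sub>L proj d) x) i"
    by (simp add: coord_mat_op section_mat_def coord_proj pu mult.commute)
qed

section \<open>Asymptotic intertwining throughout the Cuntz algebra and \<open>S_eta\<close>\<close>

lemma asymp_intertwining_zero: "asymp_intertwining N (\<lambda>_. 0)"
  by (rule asymp_intertwining_exact) simp_all

lemma bounded_ops_alt: "A \<in> bounded_ops \<longleftrightarrow> (\<forall>c x. A (scalar_op c x) = scalar_op c (A x))"
  by (simp add: bounded_ops_def scalar_op.rep_eq)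

lemma cinner_unit_left: "cinner (unit_ell2 n) x = cnj (coord x n)"
proof -
  have "(\<Sum>i. coord (unit_ell2 n) i * cnj (coord x i)) = (\<Sum>i\<in>{n}. coord (unit_ell2 n) i * cnj (coord x i))"
    by (rule suminf_finite) (auto simp: unit_ell2.rep_eq)
  then show ?thesis by (simp add: cinner_def unit_ell2.rep_eq)
qed

lemma cinner_scaleC_right: "cinner x (scaleC_ell2 c y) = cnj c * cinner x y"
  unfolding cinner_def suminf_mult[OF summable_cinner, symmetric]
  by (simp add: scaleC_ell2.rep_eq ac_simps)

text \<open>Closure under adjoints ranges over all real-linear \<open>T\<close>; conjugate linearity
  of \<open>cinner\<close> in its second argument makes such a \<open>T\<close> complex
  linear.\<close>

lemma is_adjoint_bounded_ops:
  assumes "is_adjoint S T"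
  shows "T \<in> bounded_ops"
  unfolding bounded_ops_def
proof (intro CollectI allI ell2_eqI)
  fix c x n
  have "cinner (unit_ell2 n) (T (scaleC_ell2 c x)) = cnj c * cinner (unit_ell2 n) (T x)"
    using assms unfolding is_adjoint_def by (metis cinner_scaleC_right)
  then have "cnj (coord (T (scaleC_ell2 c x)) n) = cnj (c * coord (T x) n)"
    by (simp add: cinner_unit_left)
  then show "coord (T (scaleC_ell2 c x)) n = coord (scaleC_ell2 c (T x)) n"
    by (simp only: complex_cnj_cancel_iff scaleC_ell2.rep_eq)
qed

lemma closed_bounded_ops: "closed bounded_ops"
proof -
  have "bounded_ops = (\<Inter>c x. {A. blinfun_apply A (scalar_op c x) = scalar_op c (A x)})"
    by (auto simp: bounded_ops_alt)
  also have "closed \<dots>"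
    by (intro closed_INT ballI closed_Collect_eq continuous_intros)
  finally show ?thesis .
qed

text \<open>\<open>cuntz_algebra N\<close> is the intersection of all C*-subalgebras containing the
  generators, so it is contained in this one once the generators are seen to belong to it.\<close>

lemma cstar_subalgebra_asymp_intertwining:
  assumes N: "N \<ge> 2"
  shows "cstar_subalgebra_ops {A \<in> bounded_ops. asymp_intertwining N (\<lambda>_. A)}"
    (is "cstar_subalgebra_ops ?B")
  unfolding cstar_subalgebra_ops_def
proof (intro conjI ballI allI impI)
  have N0: "N > 0" using N by simp
  show "?B \<subseteq> bounded_ops" by blast
  show "0 \<in> ?B"
    by (auto simp: bounded_ops_alt asymp_intertwining_zero blinfun.zero_right)
  show "closed ?B"
    unfolding closed_sequential_limits
  proof (intro allI impI, elim conjE)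
    fix A l assume A: "\<forall>n. A n \<in> ?B" and lim: "A \<longlonglongrightarrow> l"
    have "l \<in> bounded_ops"
      using A closed_bounded_ops lim unfolding closed_sequential_limits by blast
    moreover have "asymp_intertwining N (\<lambda>_. l)"
    proof (rule asymp_intertwining_limit[OF N])
      fix \<epsilon> :: real assume "0 < \<epsilon>"
      then obtain n where "norm (A n - l) < \<epsilon>"
        using lim by (meson LIMSEQ_D order_refl)
      then show "\<exists>Y. asymp_intertwining N Y \<and> (\<forall>n::nat. norm (l - Y n) \<le> \<epsilon>)"
        using A by (intro exI[of _ "\<lambda>_. A n"]) (auto simp: norm_minus_commute)
    qed
    ultimately show "l \<in> ?B" by blast
  qed
  fix S assume S: "S \<in> ?B"
  {
    fix T assume T: "T \<in> ?B"
    show "S + T \<in> ?B"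
      using S T by (auto simp: bounded_ops_alt blinfun.add_left blinfun.add_right
          intro: asymp_intertwining_add)
    show "S o\<^sub>L T \<in> ?B"
      using S T by (auto simp: bounded_ops_alt intro: asymp_intertwining_compose)
  }
  {
    fix c
    have "scalar_op c (scalar_op b x) = scalar_op b (scalar_op c x)" for b x
      by (rule ell2_eqI) (simp add: coord_scalar_op)
    then show "scalar_op c o\<^sub>L S \<in> ?B"
      using S asymp_intertwining_scalar[OF N0, of c]
      by (auto simp: bounded_ops_alt intro: asymp_intertwining_compose)
  }
  {
    fix T assume T: "is_adjoint S T"
    have "asymp_intertwining N (\<lambda>_. T)"
      using asymp_intertwining_adjoint[OF N0, of "\<lambda>_. S" "\<lambda>_. T"] S is_adjoint_real_adjoint[OF T] by simp
    then show "T \<in> ?B" using is_adjoint_bounded_ops[OF T] by blast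
  }
qed

lemma cuntz_algebra_intertwining:
  assumes N: "N \<ge> 2" and A: "A \<in> cuntz_algebra N"
  shows "A \<in> bounded_ops" "asymp_intertwining N (\<lambda>_. A)"
proof -
  have "cuntz_isometry N i \<in> bounded_ops" for i
    unfolding bounded_ops_alt by (auto intro!: ell2_eqI simp: coord_cuntz_isometry coord_scalar_op)
  then have "A \<in> {A \<in> bounded_ops. asymp_intertwining N (\<lambda>_. A)}"
    using A cstar_subalgebra_asymp_intertwining[OF N] asymp_intertwining_cuntz[OF N]
    unfolding cuntz_algebra_def by blast
  then show "A \<in> bounded_ops" "asymp_intertwining N (\<lambda>_. A)" by auto
qed

lemma F_eta_iff:
  "A \<in> F_eta N \<longleftrightarrow> (\<forall>n. A n \<in> carrier_mat (N ^ n) (N ^ n)) \<and> (\<exists>K. \<forall>n. norm (mat_op (A n)) \<le> K)"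
  by (auto simp: F_eta_def norm_mat_op bdd_above_def)

text \<open>A real supremum bounds its terms only if the family is bounded above; membership of both
  sequences in \<open>F_eta N\<close> provides this.\<close>

lemma norm_mat_op_diff_le_seq_norm:
  assumes "S \<in> F_eta N" "T \<in> F_eta N"
  shows "norm (mat_op (S n) - mat_op (T n)) \<le> seq_norm (\<lambda>n. S n - T n)"
proof -
  have eq: "norm (mat_op (S n) - mat_op (T n)) = mat_opnorm (S n - T n)" for n
    using assms by (simp add: F_eta_iff mat_op_diff[of _ "N ^ n" "N ^ n"] flip: norm_mat_op)
  obtain K L where "\<And>n. norm (mat_op (S n)) \<le> K" "\<And>n. norm (mat_op (T n)) \<le> L"
    using assms by (auto simp: F_eta_iff)
  then have "mat_opnorm (S n - T n) \<le> K + L" for n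
    unfolding eq[symmetric] by (meson norm_triangle_le_diff add_mono)
  then have "bdd_above (range (\<lambda>n. mat_opnorm (S n - T n)))" by (intro bdd_aboveI[of _ "K + L"]) auto
  then show ?thesis unfolding eq seq_norm_def by (rule cSUP_upper[OF UNIV_I])
qed

text \<open>Minimality again. The generating sections are products of projection, operator and
  projection, all asymptotic intertwiners with uniform norm bounds.\<close>

lemma S_eta_intertwining:
  assumes N: "N \<ge> 2" and A: "A \<in> S_eta N"
  shows "A \<in> F_eta N" "asymp_intertwining N (\<lambda>n. mat_op (A n))"
proof -
  have N0: "N > 0" using N by simp
  let ?B = "{A \<in> F_eta N. asymp_intertwining N (\<lambda>n. mat_op (A n))}"
  have "cstar_subalgebra_seq N ?B"
    unfolding cstar_subalgebra_seq_def
  proof (intro conjI ballI allI impI)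
    show "?B \<subseteq> F_eta N" by blast
    show "(\<lambda>n. 0\<^sub>m (N ^ n) (N ^ n)) \<in> ?B"
      by (auto simp: F_eta_iff mat_op_zero asymp_intertwining_zero)
  next
    fix S T assume S: "S \<in> ?B" and T: "T \<in> ?B"
    then have c: "S n \<in> carrier_mat (N ^ n) (N ^ n)" "T n \<in> carrier_mat (N ^ n) (N ^ n)" for n
      by (auto simp: F_eta_iff)
    obtain K L where KL: "\<And>n. norm (mat_op (S n)) \<le> K" "\<And>n. norm (mat_op (T n)) \<le> L"
      using S T by (auto simp: F_eta_iff)
    have "norm (mat_op (S n + T n)) \<le> K + L" for n
      unfolding mat_op_add[OF c] by (intro norm_triangle_le add_mono KL)
    then show "(\<lambda>n. S n + T n) \<in> ?B"
      using S T by (auto simp: F_eta_iff mat_op_add[OF c] intro: asymp_intertwining_add)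
    have "norm (mat_op (S n * T n)) \<le> K * L" for n
      unfolding mat_op_mult[OF c] by (intro norm_blinfun_compose_le KL)
    then show "(\<lambda>n. S n * T n) \<in> ?B"
      using S T KL mult_carrier_mat[OF c] by (auto simp: F_eta_iff mat_op_mult[OF c] intro: asymp_intertwining_compose)
  next
    fix S c assume S: "S \<in> ?B"
    obtain K where K: "\<And>n. norm (mat_op (S n)) \<le> K" using S by (auto simp: F_eta_iff)
    have "norm (mat_op (c \<cdot>\<^sub>m S n)) \<le> norm (scalar_op c) * K" for n
      unfolding mat_op_smult by (intro norm_blinfun_compose_le K order_refl)
    then show "(\<lambda>n. c \<cdot>\<^sub>m S n) \<in> ?B"
      using S K asymp_intertwining_scalar[OF N0, of c]
      by (auto simp: F_eta_iff mat_op_smult intro!: asymp_intertwining_compose)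
  next
    fix S assume S: "S \<in> ?B"
    obtain K where K: "\<And>n. norm (mat_op (S n)) \<le> K" using S by (auto simp: F_eta_iff)
    have "norm (mat_op (mat_adjoint (S n))) \<le> K" for n
      using norm_real_adjoint_le[OF real_adjoint_mat_op] K order_trans by blast
    moreover have "asymp_intertwining N (\<lambda>n. mat_op (mat_adjoint (S n)))"
      using S by (intro asymp_intertwining_adjoint[OF N0 _ real_adjoint_mat_op]) auto
    ultimately show "(\<lambda>n. mat_adjoint (S n)) \<in> ?B"
      using S by (auto simp: F_eta_iff)
  next
    fix S assume S: "S \<in> F_eta N" "\<forall>\<epsilon>>0. \<exists>T\<in>?B. seq_norm (\<lambda>n. S n - T n) < \<epsilon>"
    have "asymp_intertwining N (\<lambda>n. mat_op (S n))"
    proof (rule asymp_intertwining_limit[OF N])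
      fix \<epsilon> :: real assume "0 < \<epsilon>"
      then obtain T where T: "T \<in> ?B" "seq_norm (\<lambda>n. S n - T n) < \<epsilon>" using S(2) by blast
      have "norm (mat_op (S n) - mat_op (T n)) \<le> \<epsilon>" for n
        using norm_mat_op_diff_le_seq_norm[OF S(1), of T n] T by auto
      then show "\<exists>Y. asymp_intertwining N Y \<and> (\<forall>n. norm (mat_op (S n) - Y n) \<le> \<epsilon>)"
        using T(1) by (intro exI[of _ "\<lambda>n. mat_op (T n)"]) auto
    qed
    then show "S \<in> ?B" using S(1) by blast
  qed
  moreover have "(\<lambda>n. section_mat (N ^ n) T) \<in> ?B" if T: "T \<in> cuntz_algebra N" for T
  proof -
    note T = cuntz_algebra_intertwining[OF N T]
    have PT: "norm (proj (N ^ n) o\<^sub>L T) \<le> 1 * norm T" for n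
      by (intro norm_blinfun_compose_le norm_proj order_refl)
    have "asymp_intertwining N (\<lambda>n. proj (N ^ n) o\<^sub>L T)"
      by (rule asymp_intertwining_compose[where K = 1 and L = "norm T"])
        (simp_all add: asymp_intertwining_proj[OF N0] norm_proj T)
    then have "asymp_intertwining N (\<lambda>n. proj (N ^ n) o\<^sub>L T o\<^sub>L proj (N ^ n))"
      by (rule asymp_intertwining_compose[OF _ PT asymp_intertwining_proj[OF N0] norm_proj])
    moreover have "norm (mat_op (section_mat (N ^ n) T)) \<le> 1 * norm T * 1" for n
      unfolding mat_op_section_mat[OF T(1)] by (intro norm_blinfun_compose_le PT norm_proj)
    moreover have "section_mat (N ^ n) T \<in> carrier_mat (N ^ n) (N ^ n)" for n
      by (simp add: section_mat_def)
    ultimately show ?thesis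
      by (auto simp: F_eta_iff mat_op_section_mat[OF T(1)])
  qed
  ultimately have "A \<in> ?B" using A unfolding S_eta_def by blast
  then show "A \<in> F_eta N" "asymp_intertwining N (\<lambda>n. mat_op (A n))" by auto
qed

subsection \<open>Stability and singular values\<close>

text \<open>Beyond any index some \<open>A m\<close> is singular or has an inverse of norm above
  \<open>1 / \<epsilon>\<close>. In the first case a kernel vector serves, in the second the image
  under the inverse of a vector which it stretches by more than
  \<open>1 / \<epsilon>\<close>.\<close>

lemma not_stable_seq_almost_null_vector:
  assumes A: "\<And>n. A n \<in> carrier_mat (d n) (d n)" and "\<not> stable_seq A" and "0 < \<epsilon>"
  obtains m v where "m \<ge> m\<^sub>0" "v \<in> carrier_vec (d m)" "vec2norm v = 1"
    "vec2norm (A m *\<^sub>v v) \<le> \<epsilon>"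
proof -
  obtain m where m: "m \<ge> m\<^sub>0"
    and unst: "\<not> (invertible_mat (A m) \<and>
      (\<forall>B. inverts_mat (A m) B \<and> inverts_mat B (A m) \<longrightarrow> mat_opnorm B \<le> 1 / \<epsilon>))"
    using assms(2) unfolding stable_seq_def by metis
  have "\<exists>v. v \<in> carrier_vec (d m) \<and> v \<noteq> 0\<^sub>v (d m) \<and> vec2norm (A m *\<^sub>v v) \<le> \<epsilon> * vec2norm v"
  proof (cases "invertible_mat (A m)")
    case False
    have "det (A m) = 0"
    proof (rule ccontr)
      assume "det (A m) \<noteq> 0"
      then have "A m \<in> Units (ring_mat TYPE(complex) (d m) ())"
        by (rule det_non_zero_imp_unit[OF A])
      then obtain B where "B \<in> carrier_mat (d m) (d m)" "B * A m = 1\<^sub>m (d m)" "A m * B = 1\<^sub>m (d m)"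
        unfolding Units_def ring_mat_def by auto
      then show False
        using False A[of m] by (auto simp: invertible_mat_def inverts_mat_def)
    qed
    then obtain v where v: "v \<in> carrier_vec (d m)" "v \<noteq> 0\<^sub>v (d m)" "A m *\<^sub>v v = 0\<^sub>v (d m)"
      using det_0_iff_vec_prod_zero[OF A] by blast
    then have "vec2norm (A m *\<^sub>v v) = 0" by (simp add: vec2norm_def)
    then show ?thesis using v \<open>0 < \<epsilon>\<close> by (intro exI[of _ v]) auto
  next
    case True
    then obtain B where B: "A m * B = 1\<^sub>m (dim_row (A m))" "B * A m = 1\<^sub>m (dim_row B)"
        "\<not> mat_opnorm B \<le> 1 / \<epsilon>"
      using unst unfolding inverts_mat_def by blast
    \<comment> \<open>\<open>inverts_mat\<close> does not prescribe the shape of \<open>B\<close>;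
      comparing column counts in the two products determines it.\<close>
    have Bc: "B \<in> carrier_mat (d m) (d m)"
      using arg_cong[OF B(1), of dim_col] arg_cong[OF B(2), of dim_col] A[of m] by auto
    have "\<not> (\<forall>v\<in>carrier_vec (d m). vec2norm (B *\<^sub>v v) \<le> 1 / \<epsilon> * vec2norm v)"
    proof
      assume bound: "\<forall>v\<in>carrier_vec (d m). vec2norm (B *\<^sub>v v) \<le> 1 / \<epsilon> * vec2norm v"
      have "norm (mat_op B) \<le> 1 / \<epsilon>"
      proof (rule norm_blinfun_bound)
        fix x
        have "norm (mat_op B x) \<le> 1 / \<epsilon> * vec2norm (vec (d m) (coord x))"
          using bound Bc by (simp add: norm_mat_op_apply)
        also have "\<dots> \<le> 1 / \<epsilon> * norm x"
          using \<open>0 < \<epsilon>\<close> norm_coord_sum_le[of x "d m"]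
          by (intro mult_left_mono) (simp_all add: vec2norm_L2_set cong: L2_set_cong_simp)
        finally show "norm (mat_op B x) \<le> 1 / \<epsilon> * norm x" .
      qed (use \<open>0 < \<epsilon>\<close> in simp)
      then show False using B(3) by (simp add: norm_mat_op)
    qed
    then obtain w where w: "w \<in> carrier_vec (d m)" "1 / \<epsilon> * vec2norm w < vec2norm (B *\<^sub>v w)"
      by (auto simp: not_le)
    define v where "v = B *\<^sub>v w"
    have v: "v \<in> carrier_vec (d m)" using Bc w by (simp add: v_def)
    have "A m *\<^sub>v v = w"
      using A[of m] Bc w B(1) by (simp add: v_def flip: assoc_mult_mat_vec[of _ "d m" "d m" _ "d m"])
    moreover have "vec2norm w < \<epsilon> * vec2norm v"
      using w(2) \<open>0 < \<epsilon>\<close> by (simp add: v_def field_simps)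
    moreover have "v \<noteq> 0\<^sub>v (d m)"
    proof
      assume "v = 0\<^sub>v (d m)"
      then have "vec2norm v = 0" by (simp add: vec2norm_def)
      then show False using \<open>vec2norm w < \<epsilon> * vec2norm v\<close> vec2norm_nonneg[of w] by simp
    qed
    ultimately show ?thesis using v by (intro exI[of _ v]) auto
  qed
  then obtain v where v: "v \<in> carrier_vec (d m)" "v \<noteq> 0\<^sub>v (d m)"
      "vec2norm (A m *\<^sub>v v) \<le> \<epsilon> * vec2norm v" by blast
  have v0: "0 < vec2norm v"
    using vec2norm_eq_0_iff[OF v(1)] v(2) vec2norm_nonneg[of v] by linarith
  let ?u = "complex_of_real (1 / vec2norm v) \<cdot>\<^sub>v v"
  have "A m *\<^sub>v ?u = complex_of_real (1 / vec2norm v) \<cdot>\<^sub>v (A m *\<^sub>v v)"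
    by (rule mult_mat_vec[OF A v(1)])
  then have "vec2norm (A m *\<^sub>v ?u) \<le> \<epsilon>"
    using v(3) v0 by (simp add: vec2norm_smult norm_divide divide_le_eq)
  moreover have "vec2norm ?u = 1"
    using v0 by (simp add: vec2norm_smult norm_divide)
  ultimately show thesis using that[of m ?u] m v(1) by simp
qed

lemma stable_seq_bounded_below:
  assumes A: "\<And>n. A n \<in> carrier_mat (d n) (d n)" and "stable_seq A"
  obtains \<delta> n\<^sub>0 where "\<delta> > 0"
    "\<And>n v. n \<ge> n\<^sub>0 \<Longrightarrow> v \<in> carrier_vec (d n) \<Longrightarrow> \<delta> * vec2norm v \<le> vec2norm (A n *\<^sub>v v)"
proof -
  obtain n\<^sub>0 M where st: "\<And>n. n \<ge> n\<^sub>0 \<Longrightarrow> invertible_mat (A n)"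
      "\<And>n B. n \<ge> n\<^sub>0 \<Longrightarrow> inverts_mat (A n) B \<Longrightarrow> inverts_mat B (A n) \<Longrightarrow> mat_opnorm B \<le> M"
    using assms(2) unfolding stable_seq_def by blast
  \<comment> \<open>Raising \<open>M\<close> to at least 1 makes its reciprocal a positive
    constant.\<close>
  define M' where "M' = max M 1"
  have "1 / M' * vec2norm v \<le> vec2norm (A n *\<^sub>v v)"
    if n: "n \<ge> n\<^sub>0" and v: "v \<in> carrier_vec (d n)" for n v
  proof -
    obtain B where B: "inverts_mat (A n) B" "inverts_mat B (A n)"
      using st(1)[OF n] unfolding invertible_mat_def by blast
    have B': "A n * B = 1\<^sub>m (dim_row (A n))" "B * A n = 1\<^sub>m (dim_row B)"
      using B by (auto simp: inverts_mat_def)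
    have Bc: "B \<in> carrier_mat (d n) (d n)"
      using arg_cong[OF B'(1), of dim_col] arg_cong[OF B'(2), of dim_col] A[of n] by auto
    have w: "A n *\<^sub>v v \<in> carrier_vec (dim_col B)"
      using A[of n] v Bc by (metis carrier_matD(2) mult_mat_vec_carrier)
    have "B *\<^sub>v (A n *\<^sub>v v) = v"
      using A[of n] Bc v B'(2) by (simp flip: assoc_mult_mat_vec[of _ "d n" "d n" _ "d n"])
    then have "vec2norm v \<le> norm (mat_op B) * vec2norm (A n *\<^sub>v v)"
      using vec2norm_mult_le_norm_mat_op[OF w] by simp
    also have "\<dots> \<le> M' * vec2norm (A n *\<^sub>v v)"
      using st(2)[OF n B] by (intro mult_right_mono) (auto simp: norm_mat_op M'_def)
    finally show ?thesis by (simp add: M'_def field_simps)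
  qed
  then show thesis using that[of "1 / M'" n\<^sub>0] by (simp add: M'_def)
qed

lemma sing_val_le_of_almost_null_vector:
  assumes N: "N \<ge> 2" and A: "\<And>n. A n \<in> carrier_mat (N ^ n) (N ^ n)"
    and m: "m > 0" and k: "k \<ge> 1" and n: "n \<ge> 2 * m + 1 + k"
    and inter: "\<And>r c. marker N m r c \<Longrightarrow>
      norm ((mat_op (A (m + r)) o\<^sub>L spread N m r c) - (spread N m r c o\<^sub>L mat_op (A m))) \<le> \<epsilon>"
    and v: "v \<in> carrier_vec (N ^ m)" "vec2norm v = 1" "vec2norm (A m *\<^sub>v v) \<le> \<epsilon>"
  shows "sing_val k (A n) \<le> real k * (2 * \<epsilon>)"
proof -
  have N0: "N > 0" using N by simp
  define r where "r = n - m"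
  have r: "n = m + r" "Suc m + k \<le> r" using n by (auto simp: r_def)
  \<comment> \<open>The block has \<open>r \<ge> m + 1 + k\<close> digits: \<open>m + 1\<close> for
    the marker pattern and at least \<open>k\<close> for the tail \<open>j\<close>, which fits since
    \<open>j < k \<le> N ^ k\<close>.\<close>
  define c where "c j = 1 + N ^ Suc m * j" for j :: nat
  have mk: "marker N m r (c j)" if "j < k" for j
  proof -
    have N1: "1 < N ^ Suc m" using N by (intro one_less_power) auto
    have "Suc j \<le> N ^ k" using that less_exp[of k] power_mono[of 2 N k] N by linarith
    then have "N ^ Suc m * Suc j \<le> N ^ Suc m * N ^ k" by (rule mult_le_mono2)
    also have "\<dots> \<le> N ^ r"
      unfolding power_add[symmetric] using N r(2) by (intro power_increasing) auto
    finally have "c j < N ^ r" using N1 by (simp add: c_def)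
    moreover have "c j mod N ^ Suc m = 1" using N1 by (simp only: c_def mod_mult_self2 mod_less)
    ultimately show ?thesis using r(2) by (simp add: marker_def)
  qed
  have c_inj: "c i \<noteq> c j" if "i \<noteq> j" for i j using that N0 by (simp add: c_def)
  define x where "x = vec_ell2 v"
  have xnorm: "norm x = 1" using v by (simp add: x_def norm_vec_ell2)
  have xproj: "proj (N ^ m) x = x"
    using v(1) by (intro ell2_eqI) (auto simp: coord_proj x_def vec_ell2.rep_eq)
  define y where "y j = spread N m r (c j) x" for j
  define w where "w j = vec (N ^ n) (coord (y j))" for j
  have w: "w j \<in> carrier_vec (N ^ n)" for j by (simp add: w_def)
  \<comment> \<open>\<open>x\<close> lies in the range of \<open>proj (N ^ m)\<close>, so its spread
    lies in that of \<open>proj (N ^ n)\<close>, and cutting \<open>y j\<close> down to the vector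
    \<open>w j\<close> loses nothing.\<close>
  have supp: "coord (y j) i = 0" if "j < k" "N ^ n \<le> i" for j i
  proof -
    have "y j = proj (N ^ n) (y j)"
      using arg_cong[OF proj_spread[OF N0 mk[OF that(1)]], of "\<lambda>B. blinfun_apply B x"]
      by (simp add: y_def xproj r(1))
    then have "coord (y j) i = coord (proj (N ^ n) (y j)) i" by simp
    then show ?thesis using that(2) by (simp add: coord_proj)
  qed
  show ?thesis
  proof (rule sing_val_le[OF A k, where w = w])
    show "k \<le> N ^ n"
      using n self_le_ge2_pow[OF N, of n] by linarith
    show "w j \<in> carrier_vec (N ^ n)" for j by (rule w)
    fix i j assume ij: "i < k" "j < k"
    show "w i \<bullet>c w j = (if i = j then 1 else 0)"
    proof (cases "i = j")
      case True
      have "vec2norm (w j) = norm (y j)"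
        using norm_ell2_finite_support[of "N ^ n" "y j"] supp[OF ij(2)]
        by (simp add: w_def vec2norm_L2_set cong: L2_set_cong_simp)
      also have "\<dots> = 1"
        by (simp add: y_def norm_spread_apply[OF N mk[OF ij(2)] m] xnorm)
      finally show ?thesis using True by (simp flip: vec2norm_square)
    next
      case False
      have "coord (y i) l * cnj (coord (y j) l) = 0" for l
        using coord_spread_disjoint[OF N mk[OF ij(1)] mk[OF ij(2)] c_inj[OF False], of x l x]
        by (auto simp: y_def)
      then show ?thesis using False by (simp add: w_def scalar_prod_def)
    qed
  next
    fix j assume j: "j < k"
    let ?F = "spread N m r (c j)"
    have "vec2norm (A n *\<^sub>v w j) = norm (mat_op (A n) (y j))"
      using A[of n] by (simp add: norm_mat_op_apply w_def)
    also have "mat_op (A n) (y j)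
        = ((mat_op (A (m + r)) o\<^sub>L ?F) - (?F o\<^sub>L mat_op (A m))) x + ?F (mat_op (A m) x)"
      by (simp add: y_def r(1) blinfun.diff_left)
    \<comment> \<open>One \<open>\<epsilon>\<close> pays for the commutator, the other for
      \<open>A m\<close>, whose smallness on \<open>x\<close> the isometry preserves.\<close>
    also have "norm \<dots> \<le> \<epsilon> + \<epsilon>"
    proof (intro norm_triangle_le add_mono)
      show "norm (((mat_op (A (m + r)) o\<^sub>L ?F) - (?F o\<^sub>L mat_op (A m))) x) \<le> \<epsilon>"
        using norm_blinfun[of "(mat_op (A (m + r)) o\<^sub>L ?F) - (?F o\<^sub>L mat_op (A m))" x]
          inter[OF mk[OF j]] by (simp add: xnorm)
      have "norm (?F (mat_op (A m) x)) = norm (mat_op (A m) x)"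
        by (rule norm_spread_apply[OF N mk[OF j] m])
      also have "\<dots> = vec2norm (A m *\<^sub>v v)"
        using A[of m] v(1) by (simp add: norm_mat_op_apply x_def vec_coord_vec_ell2)
      finally show "norm (?F (mat_op (A m) x)) \<le> \<epsilon>" using v(3) by simp
    qed
    finally show "vec2norm (A n *\<^sub>v w j) \<le> 2 * \<epsilon>" by simp
  qed
qed

theorem proposition6p24:
  fixes N :: nat and A :: "nat \<Rightarrow> complex mat"
  assumes "N \<ge> 2" and "A \<in> S_eta N"
  shows "(stable_seq A \<longrightarrow> (\<exists>\<delta>>0. eventually (\<lambda>n. \<delta> \<le> sing_val 1 (A n)) sequentially)) \<and>
         (\<not> stable_seq A \<longrightarrow> (\<forall>k\<ge>1. (\<lambda>n. sing_val k (A n)) \<longlonglongrightarrow> 0))"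
proof (intro conjI impI allI)
  have A: "A n \<in> carrier_mat (N ^ n) (N ^ n)" for n
    using S_eta_intertwining(1)[OF assms] by (simp add: F_eta_iff)
  {
    assume "stable_seq A"
    then obtain \<delta> n\<^sub>0 where \<delta>: "\<delta> > 0"
      "\<And>n v. n \<ge> n\<^sub>0 \<Longrightarrow> v \<in> carrier_vec (N ^ n) \<Longrightarrow> \<delta> * vec2norm v \<le> vec2norm (A n *\<^sub>v v)"
      using stable_seq_bounded_below[of A "\<lambda>n. N ^ n"] A by blast
    \<comment> \<open>Stability does not restrict the terms before \<open>n\<^sub>0\<close>, which
      may be singular, so the lower bound is claimed from \<open>n\<^sub>0\<close> on.\<close>
    have "\<delta> \<le> sing_val 1 (A n)" if "n \<ge> n\<^sub>0" for n
      by (rule sing_val_ge[OF A]) (use \<delta> that assms(1) in auto)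
    then show "\<exists>\<delta>>0. eventually (\<lambda>n. \<delta> \<le> sing_val 1 (A n)) sequentially"
      using \<delta>(1) eventually_sequentially by blast
  }
  fix k :: nat
  assume unstable: "\<not> stable_seq A" and k: "1 \<le> k"
  show "(\<lambda>n. sing_val k (A n)) \<longlonglongrightarrow> 0"
  proof (rule LIMSEQ_I)
    fix e :: real assume e: "0 < e"
    \<comment> \<open>With this choice the bound \<open>k * (2 * \<epsilon>)\<close> equals
      \<open>e / 2\<close>.\<close>
    define \<epsilon> where "\<epsilon> = e / (4 * real k)"
    have \<epsilon>: "0 < \<epsilon>" using e k by (simp add: \<epsilon>_def)
    obtain m\<^sub>0 where m\<^sub>0: "\<And>m r c. m \<ge> m\<^sub>0 \<Longrightarrow> marker N m r c \<Longrightarrow>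
        norm ((mat_op (A (m + r)) o\<^sub>L spread N m r c) - (spread N m r c o\<^sub>L mat_op (A m))) \<le> \<epsilon>"
      using asymp_intertwiningD[OF S_eta_intertwining(2)[OF assms] \<epsilon>]
      unfolding eventually_sequentially by blast
    \<comment> \<open>Starting from \<open>Suc m\<^sub>0\<close> ensures \<open>m > 0\<close>,
      without which \<open>spread\<close> is zero and not an isometry.\<close>
    obtain m v where m: "m \<ge> Suc m\<^sub>0" "v \<in> carrier_vec (N ^ m)" "vec2norm v = 1"
        "vec2norm (A m *\<^sub>v v) \<le> \<epsilon>"
      using not_stable_seq_almost_null_vector[of A "\<lambda>n. N ^ n" \<epsilon> "Suc m\<^sub>0"] A unstable \<epsilon> by blast
    show "\<exists>n\<^sub>0. \<forall>n\<ge>n\<^sub>0. norm (sing_val k (A n) - 0) < e"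
    proof (intro exI allI impI)
      \<comment> \<open>The witness is \<open>2 * m + 1 + k\<close>: one bad index \<open>m\<close>
        controls all these \<open>n\<close>, so the whole sequence converges and not only a
        subsequence.\<close>
      fix n assume n: "n \<ge> 2 * m + 1 + k"
      have "sing_val k (A n) \<le> real k * (2 * \<epsilon>)"
        using m m\<^sub>0 by (intro sing_val_le_of_almost_null_vector[OF assms(1) A _ k n]) auto
      also have "\<dots> < e" using e k by (simp add: \<epsilon>_def)
      finally have "sing_val k (A n) < e" .
      moreover have "0 \<le> sing_val k (A n)"
        by (rule sing_val_ge[OF A k]) (use n self_le_ge2_pow[OF assms(1), of n] in auto)
      ultimately show "norm (sing_val k (A n) - 0) < e" by simp
    qed
  qed
qed

end
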